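(* Let $\Omega\subset\mathbb{R}^n$ be a bounded extension domain for $W^{s,p}$ and let $V\in L^q(\Omega)$ with $q\in(1,\infty)\cap(\tfrac{n}{sp},\infty)$. Assume that $u$ is a positive eigenfunction associated to $\lambda(V)$. If $\lambda>0$ is such that there is a nonnegative eigenfunction $v$ associated to the eigenvalue $\lambda$ (for the same potential $V$), then $\lambda=\lambda(V)$ and there is $k\in\mathbb{R}$ such that $v=ku$ a.e. in $\Omega$.
   Context: Fix $n\ge 1$, $0<s<1<p<\infty$. For an open set $\Omega\subset\mathbb{R}^n$, $W^{s,p}(\Omega)$ is the space of $u\in L^p(\Omega)$ with $[u]_{s,p;\Omega}:=\left(\iint_{\Omega\times\Omega}\frac{|u(x)-u(y)|^p}{|x-y|^{n+sp}}\,dx\,dy\right)^{1/p}<\infty$, normed by $\|u\|_{s,p;\Omega}=(\|u\|_{L^p(\Omega)}^p+[u]_{s,p;\Omega}^p)^{1/p}$. When $\Omega=\mathbb{R}^n$ the set is omitted: $[u]_{s,p}$, $\|u\|_{s,p}$, $\|u\|_p$. An open set $\Omega$ is an extension domain for $W^{s,p}$ if there is $C=C(n,s,p,\Omega)>0$ such that every $u\in W^{s,p}(\Omega)$ has an extension $\tilde u\in W^{s,p}(\mathbb{R}^n)$ with $\tilde u=u$ on $\Omega$ and $\|\tilde u\|_{s,p}\le C\|u\|_{s,p;\Omega}$. $\widetilde W^{s,p}(\Omega)$ is the space of all $u\in W^{s,p}(\Omega)$ whose extension by zero outside $\Omega$ belongs to $W^{s,p}(\mathbb{R}^n)$, normed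 by the $W^{s,p}(\mathbb{R}^n)$ norm of the zero extension; such $u$ are always identified with their zero extension to $\mathbb{R}^n$. For $u,v\in W^{s,p}(\mathbb{R}^n)$ put $\mathcal{H}(u,v)=\frac12\iint_{\mathbb{R}^n\times\mathbb{R}^n}\frac{|u(x)-u(y)|^{p-2}(u(x)-u(y))(v(x)-v(y))}{|x-y|^{n+sp}}\,dx\,dy$. A number $\lambda\in\mathbb{R}$ is an eigenvalue (for the potential $V$) if there is a nontrivial $u\in\widetilde W^{s,p}(\Omega)$ (an eigenfunction associated to $\lambda$) with $\mathcal{H}(u,v)+\int_\Omega V|u|^{p-2}uv\,dx=\lambda\int_{\mathbb{R}^n}|u|^{p-2}uv\,dx$ for all $v\in\widetilde W^{s,p}(\Omega)$. $\lambda(V)=\inf\{\frac12[u]_{s,p}^p+\int_\Omega V|u|^p\,dx\colon u\in\widetilde W^{s,p}(\Omega),\ \|u\|_p=1\}$. *)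

theory Defs
  imports "HOL-Analysis.Analysis"
begin

text \<open>
  The dimension \<open>n\<close> is \<open>DIM('a)\<close>. Elements of the function spaces are represented by
  Lebesgue measurable functions, and statements about them hold almost everywhere.
  Double integrals are taken with respect to Lebesgue measure on \<open>'a \<times> 'a\<close>. On the diagonal
  all kernels below have the value 0 because \<open>0 powr r = 0\<close>; the diagonal is a null set.
\<close>

definition Lp_space :: "real \<Rightarrow> 'a::euclidean_space set \<Rightarrow> ('a \<Rightarrow> real) set" where
  "Lp_space p \<Omega> = {u. u \<in> borel_measurable (lebesgue_on \<Omega>) \<and>
     integrable (lebesgue_on \<Omega>) (\<lambda>x. \<bar>u x\<bar> powr p)}"

definition Lp_norm :: "real \<Rightarrow> 'a::euclidean_space set \<Rightarrow> ('a \<Rightarrow> real) \<Rightarrow> real" where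
  "Lp_norm p \<Omega> u = (\<integral>x. \<bar>u x\<bar> powr p \<partial>lebesgue_on \<Omega>) powr (1 / p)"

definition gagliardo_kernel ::
    "real \<Rightarrow> real \<Rightarrow> ('a::euclidean_space \<Rightarrow> real) \<Rightarrow> 'a \<times> 'a \<Rightarrow> real" where
  "gagliardo_kernel s p u = (\<lambda>(x, y).
     \<bar>u x - u y\<bar> powr p / norm (x - y) powr (real DIM('a) + s * p))"

definition gagliardo_seminorm ::
    "real \<Rightarrow> real \<Rightarrow> 'a::euclidean_space set \<Rightarrow> ('a \<Rightarrow> real) \<Rightarrow> real" where
  "gagliardo_seminorm s p \<Omega> u =
     (\<integral>z. gagliardo_kernel s p u z \<partial>lebesgue_on (\<Omega> \<times> \<Omega>)) powr (1 / p)"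

definition frac_sobolev ::
    "real \<Rightarrow> real \<Rightarrow> 'a::euclidean_space set \<Rightarrow> ('a \<Rightarrow> real) set" where
  "frac_sobolev s p \<Omega> = {u \<in> Lp_space p \<Omega>.
     integrable (lebesgue_on (\<Omega> \<times> \<Omega>)) (gagliardo_kernel s p u)}"

definition frac_sobolev_norm ::
    "real \<Rightarrow> real \<Rightarrow> 'a::euclidean_space set \<Rightarrow> ('a \<Rightarrow> real) \<Rightarrow> real" where
  "frac_sobolev_norm s p \<Omega> u =
     (Lp_norm p \<Omega> u powr p + gagliardo_seminorm s p \<Omega> u powr p) powr (1 / p)"

definition extension_domain :: "real \<Rightarrow> real \<Rightarrow> 'a::euclidean_space set \<Rightarrow> bool" where
  "extension_domain s p \<Omega> \<longleftrightarrow> open \<Omega> \<and>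
     (\<exists>C>0. \<forall>u\<in>frac_sobolev s p \<Omega>. \<exists>w\<in>frac_sobolev s p UNIV.
        (AE x in lebesgue_on \<Omega>. w x = u x) \<and>
        frac_sobolev_norm s p UNIV w \<le> C * frac_sobolev_norm s p \<Omega> u)"

definition zero_ext :: "'a set \<Rightarrow> ('a \<Rightarrow> real) \<Rightarrow> 'a \<Rightarrow> real" where
  "zero_ext \<Omega> u = (\<lambda>x. if x \<in> \<Omega> then u x else 0)"

text \<open>
  The space \<open>W\<close>-tilde, with every element already replaced by its extension by zero; thus
  its elements are functions on the whole space that vanish outside \<open>\<Omega>\<close>.
\<close>

definition frac_sobolev0 ::
    "real \<Rightarrow> real \<Rightarrow> 'a::euclidean_space set \<Rightarrow> ('a \<Rightarrow> real) set" where
  "frac_sobolev0 s p \<Omega> =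
     zero_ext \<Omega> ` {u \<in> frac_sobolev s p \<Omega>. zero_ext \<Omega> u \<in> frac_sobolev s p UNIV}"

definition frac_form ::
    "real \<Rightarrow> real \<Rightarrow> ('a::euclidean_space \<Rightarrow> real) \<Rightarrow> ('a \<Rightarrow> real) \<Rightarrow> real" where
  "frac_form s p u v = 1 / 2 * (\<integral>(x, y).
     \<bar>u x - u y\<bar> powr (p - 2) * (u x - u y) * (v x - v y) /
       norm (x - y) powr (real DIM('a) + s * p) \<partial>(lebesgue :: ('a \<times> 'a) measure))"

definition eigenfunction ::
    "real \<Rightarrow> real \<Rightarrow> 'a::euclidean_space set \<Rightarrow> ('a \<Rightarrow> real) \<Rightarrow> real \<Rightarrow> ('a \<Rightarrow> real) \<Rightarrow> bool" where
  "eigenfunction s p \<Omega> V l u \<longleftrightarrow>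
     u \<in> frac_sobolev0 s p \<Omega> \<and> \<not> (AE x in lebesgue. u x = 0) \<and>
     (\<forall>v\<in>frac_sobolev0 s p \<Omega>.
        frac_form s p u v + (\<integral>x. V x * \<bar>u x\<bar> powr (p - 2) * u x * v x \<partial>lebesgue_on \<Omega>)
          = l * (\<integral>x. \<bar>u x\<bar> powr (p - 2) * u x * v x \<partial>lebesgue))"

definition first_eigenvalue ::
    "real \<Rightarrow> real \<Rightarrow> 'a::euclidean_space set \<Rightarrow> ('a \<Rightarrow> real) \<Rightarrow> real" where
  "first_eigenvalue s p \<Omega> V =
     Inf {1 / 2 * gagliardo_seminorm s p UNIV u powr p
            + (\<integral>x. V x * \<bar>u x\<bar> powr p \<partial>lebesgue_on \<Omega>) | u.
          u \<in> frac_sobolev0 s p \<Omega> \<and> Lp_norm p UNIV u = 1}"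

end

theory Submission
  imports Defs
begin

text \<open>
  Both claims follow from the discrete Picone inequality: for \<open>a, b \<ge> 0\<close> and \<open>c, d > 0\<close>,
  \<open>\<bar>a - b\<bar>^p - \<bar>c - d\<bar>^(p-2) (c - d) (a^p / c^(p-1) - b^p / d^(p-1)) \<ge> 0\<close>,
  with equality only if \<open>a d = b c\<close>. Call the left-hand side the Picone defect.

  Let \<open>u, v \<ge> 0\<close> be eigenfunctions for \<open>k\<close> and \<open>l\<close>, with \<open>u > 0\<close> in \<open>\<Omega>\<close>. With \<open>h = min u M\<close> and
  \<open>\<epsilon> > 0\<close>, the quotient \<open>h^p / (v + \<epsilon>)^(p-1)\<close> is a Lipschitz function of \<open>(u, v)\<close>, hence an
  admissible test function in the equation of \<open>v\<close>. Testing gives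
  \<open>\<integral>\<integral> defect(h, v + \<epsilon>) / \<bar>x - y\<bar>^(n+sp) = [h]^p - 2 (l \<integral> z - \<integral> V z)\<close> with
  \<open>z = h^p (v / (v + \<epsilon>))^(p-1)\<close>. Since \<open>0 \<le> z \<le> M^p\<close>, integrability of \<open>V\<close> alone makes the
  right-hand side converge as \<open>\<epsilon>\<close> tends to 0, and Fatou's lemma applies to the left-hand side
  (\<open>picone_fatou\<close>). This is used twice.

  \<^item> On the product of \<open>{v = 0} \<inter> \<Omega>\<close> and \<open>{v > 0}\<close> the defect tends to infinity, while its integral
    stays bounded. So one of the two sets is null, and \<open>v > 0\<close> almost everywhere in \<open>\<Omega>\<close>
    (\<open>nonneg_eigenfunction_pos\<close>). Thus the strong minimum principle comes directly from the
    nonlocality of the form.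

  \<^item> Once \<open>v > 0\<close>, the bound is \<open>\<integral>\<integral> defect(h, v) / \<bar>x - y\<bar>^(n+sp) \<le> [h]^p - 2 (l \<integral> h^p - \<integral> V h^p)\<close>.
    The potential term is eliminated by testing the equation of \<open>u\<close> with \<open>h^p / u^(p-1)\<close>, which
    is a Lipschitz function of \<open>u\<close>. Because \<open>V h^p\<close> is bounded by a multiple of \<open>\<bar>V\<bar>\<close>, no integrability of
    \<open>V u^p\<close>, and so no Sobolev embedding, is needed. As \<open>M\<close> tends to infinity,
    \<open>\<integral>\<integral> defect(u, v) / \<bar>x - y\<bar>^(n+sp) \<le> 2 (k - l) \<integral> u^p\<close> (\<open>eigenvalue_comparison\<close>).

  The last inequality gives \<open>l \<le> k\<close>. After the first step its hypotheses are symmetric in \<open>u\<close> and \<open>v\<close>,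
  so \<open>k = l\<close>; then the defect vanishes almost everywhere and the equality case of Picone's
  inequality yields \<open>u x * v y = u y * v x\<close>, that is, \<open>v\<close> is a multiple of \<open>u\<close>.
\<close>

section \<open>The discrete Picone inequality\<close>

lemma powr_gt_tangent_one:
  fixes x p :: real
  assumes "1 < p" "0 \<le> x" "x \<noteq> 1"
  shows "1 + p * (x - 1) < x powr p"
proof (cases "x = 0")
  case True
  then show ?thesis using assms by simp
next
  case False
  then have x: "0 < x" using assms by simp
  have "ln (inverse x) \<noteq> inverse x - 1"
    using ln_eq_minus_one[of "inverse x"] x assms by auto
  with ln_le_minus_one[of "inverse x"] x have "ln (inverse x) < inverse x - 1" by simp
  then have "1 - inverse x < ln x" using x by (simp add: ln_inverse)
  then have "x * (1 - inverse x) < x * ln x" using x by simp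
  then have xl: "x - 1 < x * ln x" using x by (simp add: algebra_simps)
  have "1 + p * (x - 1) = x + (p - 1) * (x - 1)" by (simp add: algebra_simps)
  also have "\<dots> < x + (p - 1) * (x * ln x)" using xl assms by simp
  also have "\<dots> = x * (1 + (p - 1) * ln x)" by (simp add: algebra_simps)
  also have "\<dots> \<le> x * exp ((p - 1) * ln x)"
    using x by (intro mult_left_mono exp_ge_add_one_self) auto
  also have "\<dots> = x powr 1 * x powr (p - 1)" using x by (simp add: powr_def)
  also have "\<dots> = x powr p" using powr_add[of x 1 "p - 1"] x by simp
  finally show ?thesis .
qed

lemma powr_gt_tangent:
  fixes x m p :: real
  assumes p: "1 < p" and m: "0 < m" and x: "0 \<le> x" "x \<noteq> m"
  shows "m powr p + p * m powr (p - 1) * (x - m) < x powr p"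
proof -
  have "1 + p * (x / m - 1) < (x / m) powr p"
    using assms by (intro powr_gt_tangent_one) auto
  then have "m powr p * (1 + p * (x / m - 1)) < m powr p * (x / m) powr p"
    using m by (intro mult_strict_left_mono) auto
  also have "\<dots> = x powr p" using m x by (simp add: powr_divide)
  also have "m powr p * (1 + p * (x / m - 1)) = m powr p + p * m powr (p - 1) * (x - m)"
    using m by (simp add: powr_diff field_simps)
  finally show ?thesis .
qed

lemma powr_ge_tangent:
  fixes x m p :: real
  assumes "1 < p" "0 \<le> m" "0 \<le> x"
  shows "m powr p + p * m powr (p - 1) * (x - m) \<le> x powr p"
  using powr_gt_tangent[of p m x] assms by (cases "m = 0"; cases "x = m") auto

lemma powr_convex_comb_le:
  fixes X Y t p :: real
  assumes p: "1 < p" and t: "0 < t" "t < 1" and X: "0 \<le> X" and Y: "0 \<le> Y"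
  shows "((1 - t) * X + t * Y) powr p \<le> (1 - t) * X powr p + t * Y powr p"
    and "X \<noteq> Y \<Longrightarrow> ((1 - t) * X + t * Y) powr p < (1 - t) * X powr p + t * Y powr p"
proof -
  define m where "m = (1 - t) * X + t * Y"
  have m0: "0 \<le> m" using assms by (simp add: m_def)
  have eq: "m powr p = (1 - t) * (m powr p + p * m powr (p - 1) * (X - m))
     + t * (m powr p + p * m powr (p - 1) * (Y - m))"
    by (simp add: m_def algebra_simps)
  have a: "(1 - t) * (m powr p + p * m powr (p - 1) * (X - m)) \<le> (1 - t) * X powr p"
    using powr_ge_tangent[OF p m0 X] t by simp
  have b: "t * (m powr p + p * m powr (p - 1) * (Y - m)) \<le> t * Y powr p"
    using powr_ge_tangent[OF p m0 Y] t by simp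
  show "((1 - t) * X + t * Y) powr p \<le> (1 - t) * X powr p + t * Y powr p"
    using eq a b by (simp add: m_def)
  assume ne: "X \<noteq> Y"
  then have "m > 0" using X Y t unfolding m_def
    by (smt (verit) mult_nonneg_nonneg mult_pos_pos)
  moreover have "X \<noteq> m" using ne t
  proof -
    have "X - m = t * (X - Y)" by (simp add: m_def algebra_simps)
    then show ?thesis using ne t by auto
  qed
  ultimately have "(1 - t) * (m powr p + p * m powr (p - 1) * (X - m)) < (1 - t) * X powr p"
    using powr_gt_tangent[OF p _ X] t by simp
  then show "((1 - t) * X + t * Y) powr p < (1 - t) * X powr p + t * Y powr p"
    using eq b by (simp add: m_def)
qed

text \<open>
  The difference of the two sides of the discrete Picone inequality, where \<open>a, b\<close> are the values of
  the numerator and \<open>c, d\<close> those of the denominator at two points. If \<open>c = 0\<close> the quotient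
  \<open>a powr p / c powr (p - 1)\<close> is 0; for \<open>a = 0\<close> this is the value that the limits
  below require.
\<close>

definition picone_defect :: "real \<Rightarrow> real \<Rightarrow> real \<Rightarrow> real \<Rightarrow> real \<Rightarrow> real" where
  "picone_defect p a b c d = \<bar>a - b\<bar> powr p
     - \<bar>c - d\<bar> powr (p - 2) * (c - d) * (a powr p / c powr (p - 1) - b powr p / d powr (p - 1))"

lemma picone_defect_commute: "picone_defect p a b c d = picone_defect p b a d c"
  by (simp add: picone_defect_def abs_minus_commute algebra_simps)

lemma abs_powr_mult_self: "\<bar>x\<bar> powr (p - 2) * x = sgn x * \<bar>x\<bar> powr (p - 1)" for x p :: real
proof (cases "x = 0")
  case False
  have "\<bar>x\<bar> powr (p - 1) = \<bar>x\<bar> powr (p - 2) * \<bar>x\<bar>"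
    using False powr_add[of "\<bar>x\<bar>" "p - 2" 1] by simp
  then show ?thesis by (simp add: sgn_if)
qed simp

text \<open>
  With \<open>t = d / c\<close>, the inequality is the convexity of \<open>r powr p\<close> applied to
  \<open>\<bar>a - b\<bar> + b = (1 - t) * (\<bar>a - b\<bar> / (1 - t)) + t * (b / t)\<close>, followed by \<open>a \<le> \<bar>a - b\<bar> + b\<close>.
\<close>

lemma picone_defect_order:
  fixes a b c d p :: real
  assumes p: "1 < p" and a: "0 \<le> a" and b: "0 \<le> b" and d: "0 < d" and cd: "d < c"
  shows "0 \<le> picone_defect p a b c d"
    and "picone_defect p a b c d = 0 \<Longrightarrow> a * d = b * c"
proof -
  define t where "t = d / c"
  have c: "0 < c" using d cd by simp
  have t: "0 < t" "t < 1" using d cd by (auto simp: t_def)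
  define X Y where "X = \<bar>a - b\<bar> / (1 - t)" and "Y = b / t"
  have XY: "0 \<le> X" "0 \<le> Y" using t b by (auto simp: X_def Y_def)
  have m: "(1 - t) * X + t * Y = \<bar>a - b\<bar> + b" using t by (simp add: X_def Y_def)
  have pow: "(1 - t) powr (p - 1) * ((1 - t) * X powr p) = \<bar>a - b\<bar> powr p"
    using t by (simp add: X_def powr_divide powr_diff)
  have pow2: "t * Y powr p = b powr p / t powr (p - 1)"
    using t b by (simp add: Y_def powr_divide powr_diff)
  have "\<bar>c - d\<bar> powr (p - 2) * (c - d) = (c - d) powr (p - 1)"
    using abs_powr_mult_self[of "c - d" p] cd by simp
  also have "\<dots> = (c * (1 - t)) powr (p - 1)" using c by (simp add: t_def algebra_simps)
  also have "\<dots> = c powr (p - 1) * (1 - t) powr (p - 1)"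
    using c t by (simp add: powr_mult)
  finally have L: "\<bar>c - d\<bar> powr (p - 2) * (c - d) = c powr (p - 1) * (1 - t) powr (p - 1)" .
  have d': "d = c * t" using c by (simp add: t_def)
  have R: "c powr (p - 1) * (a powr p / c powr (p - 1) - b powr p / d powr (p - 1))
      = a powr p - b powr p / t powr (p - 1)"
    using c t by (simp add: d' powr_mult field_simps)
  have D: "picone_defect p a b c d = (1 - t) powr (p - 1) *
     ((1 - t) * X powr p + t * Y powr p - a powr p)"
  proof -
    define E where "E = a powr p / c powr (p - 1) - b powr p / d powr (p - 1)"
    have "picone_defect p a b c d = \<bar>a - b\<bar> powr p - (1 - t) powr (p - 1) * (c powr (p - 1) * E)"
      by (simp add: picone_defect_def L E_def mult.assoc mult.left_commute)
    also have "c powr (p - 1) * E = a powr p - t * Y powr p" using R pow2 by (simp add: E_def)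
    finally show ?thesis by (simp add: pow[symmetric] algebra_simps)
  qed
  have ab: "a powr p \<le> (\<bar>a - b\<bar> + b) powr p" using a p by (intro powr_mono2) auto
  have jen: "(\<bar>a - b\<bar> + b) powr p \<le> (1 - t) * X powr p + t * Y powr p"
    using powr_convex_comb_le(1)[OF p t XY] by (simp add: m)
  show "0 \<le> picone_defect p a b c d" unfolding D using ab jen by simp
  assume "picone_defect p a b c d = 0"
  then have z: "(1 - t) * X powr p + t * Y powr p = a powr p" using t by (simp add: D)
  then have "X = Y" using powr_convex_comb_le(2)[OF p t XY] ab by (auto simp: m)
  moreover have "a = \<bar>a - b\<bar> + b"
  proof (rule ccontr)
    assume "a \<noteq> \<bar>a - b\<bar> + b"
    then have "a powr p < (\<bar>a - b\<bar> + b) powr p" using a p by (intro powr_less_mono2) auto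
    then show False using jen z by simp
  qed
  ultimately have "a - b = (1 - t) * (b / t)" using t by (simp add: X_def Y_def field_simps)
  then have "a * t = b" using t by (simp add: field_simps)
  then show "a * d = b * c" using d' by (simp add: mult.commute mult.left_commute)
qed

lemma picone_defect_nonneg:
  fixes a b c d p :: real
  assumes "1 < p" "0 \<le> a" "0 \<le> b" "0 < c" "0 < d"
  shows "0 \<le> picone_defect p a b c d"
proof (cases c d rule: linorder_cases)
  case equal
  then show ?thesis by (simp add: picone_defect_def)
next
  case less
  then show ?thesis
    using picone_defect_order(1)[of p b a c d] assms by (simp add: picone_defect_commute[of p a])
next
  case greater
  then show ?thesis using picone_defect_order(1)[of p a b d c] assms by simp
qed

lemma picone_defect_eq_0D:
  fixes a b c d p :: real
  assumes "1 < p" "0 \<le> a" "0 \<le> b" "0 < c" "0 < d" "picone_defect p a b c d = 0"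
  shows "a * d = b * c"
proof (cases c d rule: linorder_cases)
  case equal
  then show ?thesis using assms by (simp add: picone_defect_def)
next
  case less
  then show ?thesis
    using picone_defect_order(2)[of p b a c d] assms by (simp add: picone_defect_commute[of p a])
next
  case greater
  then show ?thesis using picone_defect_order(2)[of p a b d c] assms by simp
qed

section \<open>Fractional Sobolev functions and their double integrals\<close>

lemma powr_add_le:
  fixes a b p :: real
  assumes "0 \<le> p" "0 \<le> a" "0 \<le> b"
  shows "(a + b) powr p \<le> 2 powr p * (a powr p + b powr p)"
proof -
  have "(a + b) powr p \<le> (2 * max a b) powr p" using assms by (intro powr_mono2) auto
  also have "\<dots> = 2 powr p * max a b powr p" using assms by (simp add: powr_mult)
  also have "\<dots> \<le> 2 powr p * (a powr p + b powr p)"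
    by (intro mult_left_mono) (auto simp: max_def)
  finally show ?thesis .
qed

lemma powr_mult_le_add:
  fixes a b p :: real
  assumes "1 \<le> p" "0 \<le> a" "0 \<le> b"
  shows "a powr (p - 1) * b \<le> a powr p + b powr p"
proof -
  have pp: "x powr (p - 1) * x = x powr p" if "0 \<le> x" for x
    using powr_add[of x "p - 1" 1] that by (cases "x = 0") auto
  have "a powr (p - 1) * b \<le> max a b powr (p - 1) * max a b"
    using assms by (intro mult_mono powr_mono2) auto
  also have "\<dots> = max a b powr p" using assms by (intro pp) auto
  also have "\<dots> \<le> a powr p + b powr p" by (auto simp: max_def)
  finally show ?thesis .
qed

text \<open>
  Lebesgue measure on \<open>'a \<times> 'b\<close> is the completion of the product measure, so measurability of the
  projections with respect to completed measures also needs that preimages of null sets are null.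
\<close>

lemma fst_measurable_lebesgue:
  "fst \<in> (lebesgue :: ('a::euclidean_space \<times> 'b::euclidean_space) measure) \<rightarrow>\<^sub>M lebesgue"
  and snd_measurable_lebesgue:
  "snd \<in> (lebesgue :: ('a::euclidean_space \<times> 'b::euclidean_space) measure) \<rightarrow>\<^sub>M lebesgue"
proof -
  have f: "fst \<in> (lebesgue :: ('a \<times> 'b) measure) \<rightarrow>\<^sub>M lborel"
    by (intro measurable_completion) (simp flip: lborel_prod)
  have s: "snd \<in> (lebesgue :: ('a \<times> 'b) measure) \<rightarrow>\<^sub>M lborel"
    by (intro measurable_completion) (simp flip: lborel_prod)
  show "fst \<in> (lebesgue :: ('a \<times> 'b) measure) \<rightarrow>\<^sub>M lebesgue"
  proof (rule completion.measurable_completion2[OF f], rule subsetI)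
    fix N :: "'a set" assume N: "N \<in> null_sets lborel"
    have "N \<times> (UNIV :: 'b set) \<in> null_sets (lborel \<Otimes>\<^sub>M lborel)"
      using N by (intro lborel.times_in_null_sets1) auto
    then have "fst -` N \<inter> space lebesgue \<in> null_sets (lebesgue :: ('a \<times> 'b) measure)"
      by (intro null_sets_completionI) (simp add: lborel_prod vimage_fst)
    then show "N \<in> null_sets (distr lebesgue lborel (fst :: 'a \<times> 'b \<Rightarrow> 'a))"
      using N emeasure_distr[OF f, of N] by (auto simp: null_sets_def)
  qed
  show "snd \<in> (lebesgue :: ('a \<times> 'b) measure) \<rightarrow>\<^sub>M lebesgue"
  proof (rule completion.measurable_completion2[OF s], rule subsetI)
    fix N :: "'b set" assume N: "N \<in> null_sets lborel"
    have "(UNIV :: 'a set) \<times> N \<in> null_sets (lborel \<Otimes>\<^sub>M lborel)"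
      using N by (intro lborel.times_in_null_sets2) auto
    then have "snd -` N \<inter> space lebesgue \<in> null_sets (lebesgue :: ('a \<times> 'b) measure)"
      by (intro null_sets_completionI) (simp add: lborel_prod vimage_snd)
    then show "N \<in> null_sets (distr lebesgue lborel (snd :: 'a \<times> 'b \<Rightarrow> 'b))"
      using N emeasure_distr[OF s, of N] by (auto simp: null_sets_def)
  qed
qed

lemma AE_lebesgue_prodD:
  assumes "AE z in (lebesgue :: ('a::euclidean_space \<times> 'b::euclidean_space) measure). P z"
  shows "AE x in lebesgue. AE y in lebesgue. P (x, y)"
proof -
  have "AE z in (lborel :: 'a measure) \<Otimes>\<^sub>M (lborel :: 'b measure). P z"
    using assms unfolding AE_completion_iff lborel_prod .
  from lborel_pair.AE_pair[OF this] show ?thesis by (simp add: AE_completion_iff)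
qed

lemma AE_lebesgue_prodI:
  assumes "AE x in (lebesgue :: 'a::euclidean_space measure). P x"
  shows "AE z in (lebesgue :: ('a \<times> 'a) measure). P (fst z) \<and> P (snd z)"
proof -
  obtain N where N: "N \<in> null_sets (lborel :: 'a measure)" "{x. \<not> P x} \<subseteq> N"
    using assms unfolding AE_completion_iff by (auto simp: eventually_ae_filter)
  have "N \<times> UNIV \<in> null_sets (lborel \<Otimes>\<^sub>M (lborel :: 'a measure))"
    using N by (intro lborel.times_in_null_sets1) auto
  moreover have "UNIV \<times> N \<in> null_sets ((lborel :: 'a measure) \<Otimes>\<^sub>M lborel)"
    using N by (intro lborel.times_in_null_sets2) auto
  ultimately have "N \<times> UNIV \<union> UNIV \<times> N \<in> null_sets (lborel :: ('a \<times> 'a) measure)"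
    by (simp add: lborel_prod null_sets.Un)
  then have "AE z in (lborel :: ('a \<times> 'a) measure). z \<notin> N \<times> UNIV \<union> UNIV \<times> N"
    by (rule AE_not_in)
  then show ?thesis
    unfolding AE_completion_iff by (rule AE_mp) (use N in \<open>auto intro!: AE_I2\<close>)
qed

lemma fatou_integral_limit:
  fixes f :: "nat \<Rightarrow> 'a \<Rightarrow> real"
  assumes int: "\<And>j. integrable M (f j)" and nonneg: "\<And>j. AE x in M. 0 \<le> f j x"
    and lim: "(\<lambda>j. \<integral>x. f j x \<partial>M) \<longlonglongrightarrow> c"
  shows "0 \<le> c" and "(\<integral>\<^sup>+ x. liminf (\<lambda>j. ennreal (f j x)) \<partial>M) \<le> ennreal c"
proof -
  show "0 \<le> c" using lim by (rule LIMSEQ_le_const) (use nonneg in \<open>auto intro!: integral_nonneg_AE\<close>)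
  have "(\<integral>\<^sup>+ x. liminf (\<lambda>j. ennreal (f j x)) \<partial>M) \<le> liminf (\<lambda>j. \<integral>\<^sup>+ x. ennreal (f j x) \<partial>M)"
    using int by (intro nn_integral_liminf) auto
  also have "\<dots> = liminf (\<lambda>j. ennreal (\<integral>x. f j x \<partial>M))"
    using int nonneg by (simp add: nn_integral_eq_integral)
  also have "\<dots> = ennreal c"
    using lim by (intro lim_imp_Liminf tendsto_ennrealI) auto
  finally show "(\<integral>\<^sup>+ x. liminf (\<lambda>j. ennreal (f j x)) \<partial>M) \<le> ennreal c" .
qed

lemma borel_measurable_fst_snd_lebesgue:
  fixes u :: "'a::euclidean_space \<Rightarrow> real"
  assumes "u \<in> borel_measurable lebesgue"
  shows "(\<lambda>z. u (fst z)) \<in> borel_measurable (lebesgue :: ('a \<times> 'a) measure)"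
    and "(\<lambda>z. u (snd z)) \<in> borel_measurable (lebesgue :: ('a \<times> 'a) measure)"
  using measurable_compose[OF fst_measurable_lebesgue assms]
    measurable_compose[OF snd_measurable_lebesgue assms] .

lemma borel_measurable_norm_diff:
  "(\<lambda>z. norm (fst z - snd z)) \<in> borel_measurable (lebesgue :: ('a::euclidean_space \<times> 'a) measure)"
  by (intro measurable_completion) (auto intro!: borel_measurable_continuous_onI continuous_intros)

lemma gagliardo_kernel_measurable:
  fixes u :: "'a::euclidean_space \<Rightarrow> real"
  assumes "u \<in> borel_measurable lebesgue"
  shows "gagliardo_kernel s p u \<in> borel_measurable lebesgue"
proof -
  note [measurable] = borel_measurable_fst_snd_lebesgue[OF assms] borel_measurable_norm_diff
  show ?thesis unfolding gagliardo_kernel_def split_beta by measurable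
qed

lemma frac_form_integrand_measurable:
  fixes v w :: "'a::euclidean_space \<Rightarrow> real"
  assumes "v \<in> borel_measurable lebesgue" "w \<in> borel_measurable lebesgue"
  shows "(\<lambda>(x, y). \<bar>v x - v y\<bar> powr (p - 2) * (v x - v y) * (w x - w y) /
       norm (x - y) powr (real DIM('a) + s * p)) \<in> borel_measurable lebesgue"
proof -
  note [measurable] = borel_measurable_fst_snd_lebesgue[OF assms(1)] borel_measurable_fst_snd_lebesgue[OF assms(2)]
    borel_measurable_norm_diff
  show ?thesis unfolding split_beta by measurable
qed

lemma frac_sobolev_UNIV_iff:
  "u \<in> frac_sobolev s p (UNIV :: 'a::euclidean_space set) \<longleftrightarrow>
     u \<in> borel_measurable lebesgue \<and> integrable lebesgue (\<lambda>x. \<bar>u x\<bar> powr p) \<and>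
     integrable lebesgue (gagliardo_kernel s p u)"
  by (auto simp: frac_sobolev_def Lp_space_def lebesgue_on_UNIV_eq)

lemma frac_sobolev0_iff:
  fixes \<Omega> :: "'a::euclidean_space set"
  assumes "open \<Omega>"
  shows "w \<in> frac_sobolev0 s p \<Omega> \<longleftrightarrow> w \<in> frac_sobolev s p UNIV \<and> (\<forall>x. x \<notin> \<Omega> \<longrightarrow> w x = 0)"
proof
  assume "w \<in> frac_sobolev0 s p \<Omega>"
  then show "w \<in> frac_sobolev s p UNIV \<and> (\<forall>x. x \<notin> \<Omega> \<longrightarrow> w x = 0)"
    by (auto simp: frac_sobolev0_def zero_ext_def)
next
  assume w: "w \<in> frac_sobolev s p UNIV \<and> (\<forall>x. x \<notin> \<Omega> \<longrightarrow> w x = 0)"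
  have \<Omega>: "\<Omega> \<in> sets lebesgue" "\<Omega> \<times> \<Omega> \<in> sets lebesgue"
    using assms open_Times[OF assms assms] by auto
  have "zero_ext \<Omega> w = w" using w by (auto simp: zero_ext_def)
  moreover have "w \<in> frac_sobolev s p \<Omega>"
    using w \<Omega> unfolding frac_sobolev_UNIV_iff frac_sobolev_def Lp_space_def
    by (auto simp: lebesgue_on_UNIV_eq integrable_restrict_space intro: measurable_restrict_space1
        integrable_mult_indicator[where 'b=real, unfolded real_scaleR_def])
  ultimately show "w \<in> frac_sobolev0 s p \<Omega>"
    using w unfolding frac_sobolev0_def by (metis (mono_tags, lifting) image_eqI mem_Collect_eq)
qed

text \<open>
  A function whose values and increments are controlled by those of \<open>u\<close> and \<open>v\<close> inherits their
  fractional Sobolev regularity. All test functions below are shown to be admissible in this way.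
\<close>

lemma frac_sobolev_dominated:
  fixes u v w :: "'a::euclidean_space \<Rightarrow> real"
  assumes p: "0 \<le> p" and A: "0 \<le> A" and B: "0 \<le> B"
    and u: "u \<in> frac_sobolev s p UNIV" and v: "v \<in> frac_sobolev s p UNIV"
    and w: "w \<in> borel_measurable lebesgue"
    and le: "\<And>x. \<bar>w x\<bar> \<le> A * \<bar>u x\<bar> + B * \<bar>v x\<bar>"
    and lip: "\<And>x y. \<bar>w x - w y\<bar> \<le> A * \<bar>u x - u y\<bar> + B * \<bar>v x - v y\<bar>"
  shows "w \<in> frac_sobolev s p UNIV"
proof -
  have bd: "\<bar>c\<bar> powr p \<le> 2 powr p * (A powr p * \<bar>a\<bar> powr p + B powr p * \<bar>b\<bar> powr p)"
    if "\<bar>c\<bar> \<le> A * \<bar>a\<bar> + B * \<bar>b\<bar>" for a b c :: real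
  proof -
    have "\<bar>c\<bar> powr p \<le> (A * \<bar>a\<bar> + B * \<bar>b\<bar>) powr p" using that p by (intro powr_mono2) auto
    also have "\<dots> \<le> 2 powr p * ((A * \<bar>a\<bar>) powr p + (B * \<bar>b\<bar>) powr p)"
      using p A B by (intro powr_add_le) auto
    finally show ?thesis using A B by (simp add: powr_mult)
  qed
  have "integrable lebesgue (\<lambda>x. \<bar>w x\<bar> powr p)"
  proof (rule Bochner_Integration.integrable_bound)
    show "integrable lebesgue (\<lambda>x. 2 powr p * (A powr p * \<bar>u x\<bar> powr p + B powr p * \<bar>v x\<bar> powr p))"
      using u v by (auto simp: frac_sobolev_UNIV_iff)
    show "(\<lambda>x. \<bar>w x\<bar> powr p) \<in> borel_measurable lebesgue" using w by measurable
    show "AE x in lebesgue. norm (\<bar>w x\<bar> powr p)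
        \<le> norm (2 powr p * (A powr p * \<bar>u x\<bar> powr p + B powr p * \<bar>v x\<bar> powr p))"
      using bd[OF le] by (intro AE_I2) simp
  qed
  moreover have "integrable lebesgue (gagliardo_kernel s p w)"
  proof (rule Bochner_Integration.integrable_bound)
    show "integrable lebesgue (\<lambda>z. 2 powr p * (A powr p * gagliardo_kernel s p u z
        + B powr p * gagliardo_kernel s p v z))"
      using u v by (auto simp: frac_sobolev_UNIV_iff)
    show "gagliardo_kernel s p w \<in> borel_measurable lebesgue"
      using w by (rule gagliardo_kernel_measurable)
    have "\<bar>w x - w y\<bar> powr p / norm (x - y) powr (real DIM('a) + s * p)
        \<le> 2 powr p * (A powr p * \<bar>u x - u y\<bar> powr p + B powr p * \<bar>v x - v y\<bar> powr p)
          / norm (x - y) powr (real DIM('a) + s * p)" for x y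
      by (intro divide_right_mono bd lip) simp
    then show "AE z in lebesgue. norm (gagliardo_kernel s p w z) \<le> norm (2 powr p *
        (A powr p * gagliardo_kernel s p u z + B powr p * gagliardo_kernel s p v z))"
      by (intro AE_I2) (auto simp: gagliardo_kernel_def field_simps add_divide_distrib)
  qed
  ultimately show ?thesis using w by (simp add: frac_sobolev_UNIV_iff)
qed

lemma frac_form_integrable:
  fixes v w :: "'a::euclidean_space \<Rightarrow> real"
  assumes p: "1 \<le> p"
    and v: "v \<in> frac_sobolev s p UNIV" and w: "w \<in> frac_sobolev s p UNIV"
  shows "integrable lebesgue (\<lambda>(x, y). \<bar>v x - v y\<bar> powr (p - 2) * (v x - v y) * (w x - w y) /
       norm (x - y) powr (real DIM('a) + s * p))"
proof (rule Bochner_Integration.integrable_bound)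
  show "integrable lebesgue (\<lambda>z. gagliardo_kernel s p v z + gagliardo_kernel s p w z)"
    using v w by (auto simp: frac_sobolev_UNIV_iff)
  show "(\<lambda>(x, y). \<bar>v x - v y\<bar> powr (p - 2) * (v x - v y) * (w x - w y) /
       norm (x - y) powr (real DIM('a) + s * p)) \<in> borel_measurable lebesgue"
    using v w by (intro frac_form_integrand_measurable) (auto simp: frac_sobolev_UNIV_iff)
  have "\<bar>\<bar>v x - v y\<bar> powr (p - 2) * (v x - v y) * (w x - w y)\<bar>
      \<le> \<bar>v x - v y\<bar> powr p + \<bar>w x - w y\<bar> powr p" for x y
    using powr_mult_le_add[OF p, of "\<bar>v x - v y\<bar>" "\<bar>w x - w y\<bar>"]
    by (simp add: abs_powr_mult_self abs_mult abs_sgn_eq)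
  then have "\<bar>\<bar>v x - v y\<bar> powr (p - 2) * (v x - v y) * (w x - w y)\<bar>
        / norm (x - y) powr (real DIM('a) + s * p)
      \<le> (\<bar>v x - v y\<bar> powr p + \<bar>w x - w y\<bar> powr p)
        / norm (x - y) powr (real DIM('a) + s * p)" for x y
    by (intro divide_right_mono) auto
  then show "AE z in lebesgue. norm (case z of (x, y) \<Rightarrow>
        \<bar>v x - v y\<bar> powr (p - 2) * (v x - v y) * (w x - w y) /
          norm (x - y) powr (real DIM('a) + s * p))
      \<le> norm (gagliardo_kernel s p v z + gagliardo_kernel s p w z)"
    by (intro AE_I2) (auto simp: gagliardo_kernel_def abs_mult add_divide_distrib)
qed

section \<open>Admissible test functions\<close>

lemma abs_powr_diff_le:
  fixes a b M p :: real
  assumes p: "1 < p" and a: "0 \<le> a" "a \<le> M" and b: "0 \<le> b" "b \<le> M"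
  shows "\<bar>a powr p - b powr p\<bar> \<le> p * M powr (p - 1) * \<bar>a - b\<bar>"
proof -
  have *: "x powr p - y powr p \<le> p * M powr (p - 1) * \<bar>x - y\<bar>"
    if x: "0 \<le> x" "x \<le> M" and y: "0 \<le> y" for x y
  proof -
    have "x powr p - y powr p \<le> p * x powr (p - 1) * (x - y)"
      using powr_ge_tangent[OF p x(1) y] by (simp add: algebra_simps)
    also have "\<dots> \<le> p * x powr (p - 1) * \<bar>x - y\<bar>" using p by (intro mult_left_mono) auto
    also have "\<dots> \<le> p * M powr (p - 1) * \<bar>x - y\<bar>"
      using p x by (intro mult_right_mono mult_left_mono powr_mono2) auto
    finally show ?thesis .
  qed
  show ?thesis using *[OF a b(1)] *[OF b a(1)] by (simp add: abs_le_iff abs_minus_commute)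
qed

lemma abs_powr_neg_diff_le:
  fixes c d m p :: real
  assumes p: "1 < p" and m: "0 < m" and c: "m \<le> c" and d: "m \<le> d"
  shows "\<bar>c powr (1 - p) - d powr (1 - p)\<bar> \<le> (p - 1) * m powr (- p) * \<bar>c - d\<bar>"
proof -
  have *: "\<bar>y powr (1 - p) - x powr (1 - p)\<bar> \<le> (p - 1) * m powr (- p) * \<bar>y - x\<bar>"
    if x: "m \<le> x" and xy: "x < y" for x y
  proof -
    have "\<And>t. x \<le> t \<Longrightarrow> t \<le> y \<Longrightarrow>
        ((\<lambda>t. t powr (1 - p)) has_real_derivative (1 - p) * t powr (- p)) (at t)"
      using has_real_derivative_powr[of _ "1 - p"] x m by simp
    from MVT2[OF xy this] obtain t where t: "x < t" "t < y"
      "y powr (1 - p) - x powr (1 - p) = (y - x) * ((1 - p) * t powr (- p))" by auto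
    then have "\<bar>y powr (1 - p) - x powr (1 - p)\<bar> = (p - 1) * t powr (- p) * \<bar>y - x\<bar>"
      using p by (simp add: abs_mult)
    also have "\<dots> \<le> (p - 1) * m powr (- p) * \<bar>y - x\<bar>"
      using p t x m by (intro mult_right_mono mult_left_mono powr_mono2') auto
    finally show ?thesis .
  qed
  show ?thesis
    using *[OF c, of d] *[OF d, of c] by (cases c d rule: linorder_cases) (auto simp: abs_minus_commute)
qed

lemma powr_quotient_diff_le:
  fixes a b c d e M p :: real
  assumes p: "1 < p" and a: "0 \<le> a" "a \<le> M" and b: "0 \<le> b" "b \<le> M"
    and e: "0 < e" "e \<le> c" "e \<le> d"
  shows "\<bar>a powr p / c powr (p - 1) - b powr p / d powr (p - 1)\<bar>
     \<le> p * M powr (p - 1) * e powr (1 - p) * \<bar>a - b\<bar> + M powr p * ((p - 1) * e powr (- p)) * \<bar>c - d\<bar>"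
proof -
  have i: "x / y powr (p - 1) = x * y powr (1 - p)" for x y :: real
    using powr_minus[of y "p - 1"] by (simp add: divide_inverse)
  have "a powr p / c powr (p - 1) - b powr p / d powr (p - 1)
      = (a powr p - b powr p) * c powr (1 - p) + b powr p * (c powr (1 - p) - d powr (1 - p))"
    unfolding i by (simp add: algebra_simps)
  also have "\<bar>\<dots>\<bar> \<le> \<bar>a powr p - b powr p\<bar> * c powr (1 - p)
      + b powr p * \<bar>c powr (1 - p) - d powr (1 - p)\<bar>"
    by (rule order_trans[OF abs_triangle_ineq]) (simp add: abs_mult)
  also have "\<dots> \<le> (p * M powr (p - 1) * \<bar>a - b\<bar>) * e powr (1 - p)
      + M powr p * ((p - 1) * e powr (- p) * \<bar>c - d\<bar>)"
    using assms by (intro add_mono mult_mono abs_powr_diff_le abs_powr_neg_diff_le powr_mono2 powr_mono2') auto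
  finally show ?thesis by (simp add: mult_ac)
qed

text \<open>
  The identity up to \<open>M\<close>, continued by \<open>M^p t^(1-p)\<close>. For \<open>t > 0\<close> this is \<open>(min t M)^p / t^(p-1)\<close>.
\<close>

definition power_tail :: "real \<Rightarrow> real \<Rightarrow> real \<Rightarrow> real" where
  "power_tail p M t = (if t \<le> M then t else M powr p * t powr (1 - p))"

lemma powr_mult_power_tail:
  assumes "1 < p" "0 < M" "0 \<le> t"
  shows "t powr (p - 1) * power_tail p M t = min t M powr p"
proof (cases "t \<le> M")
  case True
  then show ?thesis using assms powr_add[of t "p - 1" 1] by (cases "t = 0") (auto simp: power_tail_def)
next
  case False
  then have "t powr (p - 1) * t powr (1 - p) = 1"
    using assms powr_add[of t "p - 1" "1 - p"] by simp
  then show ?thesis using False by (simp add: power_tail_def min_def mult.left_commute)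
qed

text \<open>
  Since the decaying branch has slope at least \<open>-(p - 1)\<close> on \<open>t \<ge> M\<close>, the constant \<open>p\<close> serves
  for every \<open>M\<close>; this uniformity provides the dominating function as \<open>M\<close> tends to infinity.
\<close>

lemma power_tail_lipschitz:
  assumes p: "1 < p" and M: "0 < M"
  shows "\<bar>power_tail p M t - power_tail p M r\<bar> \<le> p * \<bar>t - r\<bar>"
proof -
  have tM: "M powr p * M powr (1 - p) = M" using M powr_add[of M p "1 - p"] by simp
  have big: "\<bar>M powr p * x powr (1 - p) - M powr p * y powr (1 - p)\<bar> \<le> p * \<bar>x - y\<bar>"
    if "M \<le> x" "M \<le> y" for x y
  proof -
    have "\<bar>M powr p * x powr (1 - p) - M powr p * y powr (1 - p)\<bar>
        = M powr p * \<bar>x powr (1 - p) - y powr (1 - p)\<bar>"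
      by (simp add: abs_mult flip: right_diff_distrib)
    also have "\<dots> \<le> M powr p * ((p - 1) * M powr (- p) * \<bar>x - y\<bar>)"
      using that p M by (intro mult_left_mono abs_powr_neg_diff_le) auto
    also have "\<dots> = (p - 1) * \<bar>x - y\<bar>" using M by (simp add: powr_minus field_simps)
    also have "\<dots> \<le> p * \<bar>x - y\<bar>" by (intro mult_right_mono) auto
    finally show ?thesis .
  qed
  have small: "\<bar>x - y\<bar> \<le> p * \<bar>x - y\<bar>" for x y :: real using p mult_right_mono[of 1 p "\<bar>x - y\<bar>"] by simp
  have mixed: "\<bar>x - M powr p * y powr (1 - p)\<bar> \<le> p * \<bar>x - y\<bar>" if "x \<le> M" "M \<le> y" for x y
  proof -
    have "\<bar>x - M powr p * y powr (1 - p)\<bar> \<le> \<bar>x - M\<bar> + \<bar>M - M powr p * y powr (1 - p)\<bar>" by simp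
    also have "\<dots> \<le> p * \<bar>x - M\<bar> + p * \<bar>M - y\<bar>"
      using small[of x M] big[of M y] that by (simp add: tM)
    also have "\<dots> = p * \<bar>x - y\<bar>" using that by (simp add: algebra_simps)
    finally show ?thesis .
  qed
  consider "t \<le> M" "r \<le> M" | "t \<le> M" "M < r" | "M < t" "r \<le> M" | "M < t" "M < r" by linarith
  then show ?thesis
    using small[of t r] mixed[of t r] mixed[of r t] big[of t r]
    by cases (auto simp: power_tail_def abs_minus_commute)
qed

lemma picone_test_function:
  fixes \<Omega> :: "'a::euclidean_space set"
  assumes \<Omega>: "open \<Omega>" and p: "1 < p" and M: "0 < M" and e: "0 < e"
    and u: "u \<in> frac_sobolev0 s p \<Omega>" "\<And>x. 0 \<le> u x"
    and v: "v \<in> frac_sobolev0 s p \<Omega>" "\<And>x. 0 \<le> v x"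
  shows "(\<lambda>x. min (u x) M powr p / (v x + e) powr (p - 1)) \<in> frac_sobolev0 s p \<Omega>"
proof -
  define A B where "A = p * M powr (p - 1) * e powr (1 - p)" and "B = M powr p * ((p - 1) * e powr (- p))"
  have uv: "u \<in> frac_sobolev s p UNIV" "v \<in> frac_sobolev s p UNIV"
    using u v by (auto simp: frac_sobolev0_iff[OF \<Omega>])
  then have [measurable]: "u \<in> borel_measurable lebesgue" "v \<in> borel_measurable lebesgue"
    by (auto simp: frac_sobolev_UNIV_iff)
  have AB: "0 \<le> A" "0 \<le> B" using p by (auto simp: A_def B_def)
  have lip: "\<bar>min a M powr p / (c + e) powr (p - 1) - min b M powr p / (d + e) powr (p - 1)\<bar>
      \<le> A * \<bar>a - b\<bar> + B * \<bar>c - d\<bar>" if "0 \<le> a" "0 \<le> b" "0 \<le> c" "0 \<le> d" for a b c d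
  proof -
    have "\<bar>min a M powr p / (c + e) powr (p - 1) - min b M powr p / (d + e) powr (p - 1)\<bar>
      \<le> A * \<bar>min a M - min b M\<bar> + B * \<bar>(c + e) - (d + e)\<bar>"
      unfolding A_def B_def using that p M e by (intro powr_quotient_diff_le) auto
    also have "\<dots> \<le> A * \<bar>a - b\<bar> + B * \<bar>c - d\<bar>" using AB by (intro add_mono mult_left_mono) auto
    finally show ?thesis .
  qed
  have "(\<lambda>x. min (u x) M powr p / (v x + e) powr (p - 1)) \<in> frac_sobolev s p UNIV"
  proof (rule frac_sobolev_dominated[OF _ AB uv])
    show "\<bar>min (u x) M powr p / (v x + e) powr (p - 1)\<bar> \<le> A * \<bar>u x\<bar> + B * \<bar>v x\<bar>" for x
      using lip[of "u x" 0 "v x" 0] u(2)[of x] v(2)[of x] M by simp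
    show "\<bar>min (u x) M powr p / (v x + e) powr (p - 1) - min (u y) M powr p / (v y + e) powr (p - 1)\<bar>
        \<le> A * \<bar>u x - u y\<bar> + B * \<bar>v x - v y\<bar>" for x y
      using u v by (intro lip) auto
  qed (use p in auto)
  then show ?thesis using u(1) M by (simp add: frac_sobolev0_iff[OF \<Omega>])
qed

lemma power_tail_test_function:
  fixes \<Omega> :: "'a::euclidean_space set"
  assumes \<Omega>: "open \<Omega>" and p: "1 < p" and M: "0 < M" and u: "u \<in> frac_sobolev0 s p \<Omega>"
  shows "(\<lambda>x. power_tail p M (u x)) \<in> frac_sobolev0 s p \<Omega>"
proof -
  have u': "u \<in> frac_sobolev s p UNIV" using u by (auto simp: frac_sobolev0_iff[OF \<Omega>])
  then have [measurable]: "u \<in> borel_measurable lebesgue" by (auto simp: frac_sobolev_UNIV_iff)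
  have 0: "power_tail p M 0 = 0" using M by (simp add: power_tail_def)
  have "(\<lambda>x. power_tail p M (u x)) \<in> frac_sobolev s p UNIV"
  proof (rule frac_sobolev_dominated[OF _ _ order_refl u' u'])
    show "(\<lambda>x. power_tail p M (u x)) \<in> borel_measurable lebesgue"
      unfolding power_tail_def by measurable
    show "\<bar>power_tail p M (u x)\<bar> \<le> p * \<bar>u x\<bar> + 0 * \<bar>u x\<bar>" for x
      using power_tail_lipschitz[OF p M, of "u x" 0] by (simp add: 0)
  qed (use p M power_tail_lipschitz in auto)
  then show ?thesis using u by (simp add: frac_sobolev0_iff[OF \<Omega>] 0)
qed

lemma min_in_frac_sobolev:
  assumes p: "0 \<le> p" and M: "0 < M" and u: "u \<in> frac_sobolev s p (UNIV :: 'a::euclidean_space set)"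
  shows "(\<lambda>x. min (u x) M) \<in> frac_sobolev s p UNIV"
proof (rule frac_sobolev_dominated[OF p zero_le_one order_refl u u])
  have [measurable]: "u \<in> borel_measurable lebesgue" using u by (auto simp: frac_sobolev_UNIV_iff)
  show "(\<lambda>x. min (u x) M) \<in> borel_measurable lebesgue" by measurable
qed (use M in auto)

section \<open>Picone's inequality tested against an eigenfunction\<close>

lemma eigenfunction_eqD:
  assumes "eigenfunction s p \<Omega> V l v" "\<And>x. 0 \<le> v x" "w \<in> frac_sobolev0 s p \<Omega>"
  shows "frac_form s p v w = l * (\<integral>x. v x powr (p - 1) * w x \<partial>lebesgue)
    - (\<integral>x. V x * (v x powr (p - 1) * w x) \<partial>lebesgue_on \<Omega>)"
proof -
  have "\<bar>v x\<bar> powr (p - 2) * v x = v x powr (p - 1)" for x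
    using abs_powr_mult_self[of "v x" p] assms(2)[of x] by (cases "v x = 0") auto
  then have "frac_form s p v w + (\<integral>x. V x * (v x powr (p - 1) * w x) \<partial>lebesgue_on \<Omega>)
      = l * (\<integral>x. v x powr (p - 1) * w x \<partial>lebesgue)"
    using assms(1,3) by (simp add: eigenfunction_def mult.assoc)
  then show ?thesis by simp
qed

text \<open>
  The integrand of the double integral of the Picone defect of the numerator \<open>h\<close> and the
  denominator \<open>v\<close>, with the same singular weight as the Gagliardo kernel.
\<close>

definition picone_kernel ::
    "real \<Rightarrow> real \<Rightarrow> ('a::euclidean_space \<Rightarrow> real) \<Rightarrow> ('a \<Rightarrow> real) \<Rightarrow> 'a \<times> 'a \<Rightarrow> real" where
  "picone_kernel s p h v = (\<lambda>(x, y). picone_defect p (h x) (h y) (v x) (v y)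
     / norm (x - y) powr (real DIM('a) + s * p))"

lemma picone_kernel_measurable:
  fixes h v :: "'a::euclidean_space \<Rightarrow> real"
  assumes "h \<in> borel_measurable lebesgue" "v \<in> borel_measurable lebesgue"
  shows "picone_kernel s p h v \<in> borel_measurable lebesgue"
proof -
  note [measurable] = borel_measurable_fst_snd_lebesgue[OF assms(1)] borel_measurable_fst_snd_lebesgue[OF assms(2)]
    borel_measurable_norm_diff
  show ?thesis unfolding picone_kernel_def picone_defect_def split_beta by measurable
qed

text \<open>
  The equation of \<open>v\<close> tested with \<open>h powr p / (v + e) powr (p - 1)\<close>. Adding the constant \<open>e\<close> to \<open>v\<close>
  leaves the increments of \<open>v\<close>, hence the form, unchanged.
\<close>

lemma picone_identity:
  fixes \<Omega> :: "'a::euclidean_space set" and u v :: "'a \<Rightarrow> real"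
  assumes \<Omega>: "open \<Omega>" and p: "1 < p" and M: "0 < M" and e: "0 < e"
    and u: "u \<in> frac_sobolev0 s p \<Omega>" "\<And>x. 0 \<le> u x"
    and v: "eigenfunction s p \<Omega> V l v" "\<And>x. 0 \<le> v x"
  defines "h \<equiv> \<lambda>x. min (u x) M"
  defines "z \<equiv> \<lambda>x. h x powr p * (v x / (v x + e)) powr (p - 1)"
  defines "K \<equiv> picone_kernel s p h (\<lambda>x. v x + e)"
  shows "integrable lebesgue K" and "\<And>w. 0 \<le> K w"
    and "(\<integral>w. K w \<partial>lebesgue) = (\<integral>w. gagliardo_kernel s p h w \<partial>lebesgue)
      - 2 * (l * (\<integral>x. z x \<partial>lebesgue) - (\<integral>x. V x * z x \<partial>lebesgue_on \<Omega>))"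
proof -
  define \<phi> where "\<phi> = (\<lambda>x. h x powr p / (v x + e) powr (p - 1))"
  define F where "F = (\<lambda>(x, y). \<bar>v x - v y\<bar> powr (p - 2) * (v x - v y) * (\<phi> x - \<phi> y) /
       norm (x - y) powr (real DIM('a) + s * p))"
  have v0: "v \<in> frac_sobolev0 s p \<Omega>" using v by (simp add: eigenfunction_def)
  have \<phi>0: "\<phi> \<in> frac_sobolev0 s p \<Omega>"
    unfolding \<phi>_def h_def by (rule picone_test_function[OF \<Omega> p M e u v0 v(2)])
  have h: "h \<in> frac_sobolev s p UNIV"
    unfolding h_def using u p M by (intro min_in_frac_sobolev) (auto simp: frac_sobolev0_iff[OF \<Omega>])
  have K: "K = (\<lambda>w. gagliardo_kernel s p h w - F w)"
    by (auto simp: K_def picone_kernel_def picone_defect_def gagliardo_kernel_def F_def \<phi>_def diff_divide_distrib)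
  have Fi: "integrable lebesgue F"
    unfolding F_def using p v0 \<phi>0 by (intro frac_form_integrable) (auto simp: frac_sobolev0_iff[OF \<Omega>])
  have hi: "integrable lebesgue (gagliardo_kernel s p h)" using h by (simp add: frac_sobolev_UNIV_iff)
  show "integrable lebesgue K" unfolding K using hi Fi by simp
  show "0 \<le> K w" for w
    unfolding K_def picone_kernel_def split_beta using p u(2) v(2) M e
    by (intro divide_nonneg_nonneg picone_defect_nonneg) (auto simp: h_def add_nonneg_pos)
  have z: "v x powr (p - 1) * \<phi> x = z x" for x
    using v(2)[of x] e by (simp add: z_def \<phi>_def powr_divide)
  have "(\<integral>w. F w \<partial>lebesgue) = 2 * frac_form s p v \<phi>" by (simp add: frac_form_def F_def)
  also have "\<dots> = 2 * (l * (\<integral>x. z x \<partial>lebesgue) - (\<integral>x. V x * z x \<partial>lebesgue_on \<Omega>))"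
    using eigenfunction_eqD[OF v \<phi>0] by (simp add: z)
  finally show "(\<integral>w. K w \<partial>lebesgue) = (\<integral>w. gagliardo_kernel s p h w \<partial>lebesgue)
      - 2 * (l * (\<integral>x. z x \<partial>lebesgue) - (\<integral>x. V x * z x \<partial>lebesgue_on \<Omega>))"
    unfolding K using hi Fi by simp
qed

section \<open>Removing the regularization of the denominator\<close>

lemma picone_defect_tendsto:
  fixes a b c d p :: real
  assumes c: "0 < c \<or> a = 0" "0 \<le> c" and d: "0 < d \<or> b = 0" "0 \<le> d" and e: "e \<longlonglongrightarrow> 0"
  shows "(\<lambda>j. picone_defect p a b (c + e j) (d + e j)) \<longlonglongrightarrow> picone_defect p a b c d"
proof -
  have q: "(\<lambda>j. r powr p / (t + e j) powr (p - 1)) \<longlonglongrightarrow> r powr p / t powr (p - 1)"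
    if "0 < t \<or> r = 0" for r t
  proof (cases "r = 0")
    case False
    then have "0 < t" using that by simp
    then show ?thesis using tendsto_add[OF tendsto_const[of t] e] by (intro tendsto_intros) auto
  qed simp
  show ?thesis
    unfolding picone_defect_def using q[OF c(1)] q[OF d(1)] by (auto intro!: tendsto_intros)
qed

text \<open>
  Letting \<open>e = 1 / (j + 1)\<close> tend to 0 in \<open>picone_identity\<close>. The set where \<open>v\<close> vanishes is not yet
  known to be small; there the factor \<open>(v / (v + e)) powr (p - 1)\<close> is 0 for every \<open>e\<close>, which
  explains the case distinction in \<open>Z\<close>.
\<close>

lemma picone_fatou:
  fixes \<Omega> :: "'a::euclidean_space set" and u v :: "'a \<Rightarrow> real"
  assumes \<Omega>: "open \<Omega>" and p: "1 < p" and M: "0 < M"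
    and V: "integrable (lebesgue_on \<Omega>) V"
    and u: "u \<in> frac_sobolev0 s p \<Omega>" "\<And>x. 0 \<le> u x"
    and v: "eigenfunction s p \<Omega> V l v" "\<And>x. 0 \<le> v x"
  defines "h \<equiv> \<lambda>x. min (u x) M"
  defines "Z \<equiv> \<lambda>x. if v x = 0 then 0 else h x powr p"
  defines "c \<equiv> (\<integral>w. gagliardo_kernel s p h w \<partial>lebesgue)
      - 2 * (l * (\<integral>x. Z x \<partial>lebesgue) - (\<integral>x. V x * Z x \<partial>lebesgue_on \<Omega>))"
  shows "0 \<le> c" and "(\<integral>\<^sup>+ w. liminf (\<lambda>j. ennreal (picone_kernel s p h (\<lambda>x. v x + 1 / real (Suc j)) w))
    \<partial>lebesgue) \<le> ennreal c"
proof -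
  define z where "z = (\<lambda>j x. h x powr p * (v x / (v x + 1 / real (Suc j))) powr (p - 1))"
  define K where "K = (\<lambda>j. picone_kernel s p h (\<lambda>x. v x + 1 / real (Suc j)))"
  have v0: "v \<in> frac_sobolev0 s p \<Omega>" using v by (simp add: eigenfunction_def)
  have [measurable]: "u \<in> borel_measurable lebesgue" "v \<in> borel_measurable lebesgue"
    and ui: "integrable lebesgue (\<lambda>x. \<bar>u x\<bar> powr p)"
    using u(1) v0 by (auto simp: frac_sobolev0_iff[OF \<Omega>] frac_sobolev_UNIV_iff)
  have zm[measurable]: "z j \<in> borel_measurable lebesgue" for j unfolding z_def h_def by measurable
  have Zm[measurable]: "Z \<in> borel_measurable lebesgue" unfolding Z_def h_def by measurable
  have zm'[measurable]: "z j \<in> borel_measurable (lebesgue_on \<Omega>)" for j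
    by (intro measurable_restrict_space1 zm)
  have Zm'[measurable]: "Z \<in> borel_measurable (lebesgue_on \<Omega>)"
    by (intro measurable_restrict_space1 Zm)
  have [measurable]: "V \<in> borel_measurable (lebesgue_on \<Omega>)" using V by auto
  have zh: "0 \<le> z j x" "z j x \<le> h x powr p" for j x
  proof -
    have "(v x / (v x + 1 / real (Suc j))) powr (p - 1) \<le> 1 powr (p - 1)"
      using v(2)[of x] p by (intro powr_mono2) (auto simp: divide_le_eq add_nonneg_pos)
    then show "z j x \<le> h x powr p" unfolding z_def by (intro mult_left_le) auto
  qed (simp add: z_def)
  have hu: "h x powr p \<le> u x powr p" "h x powr p \<le> M powr p" for x
    using u(2)[of x] M p by (auto simp: h_def intro!: powr_mono2)
  have lim: "(\<lambda>j. z j x) \<longlonglongrightarrow> Z x" for x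
  proof (cases "v x = 0")
    case True
    then show ?thesis by (simp add: z_def Z_def)
  next
    case False
    then have pos: "0 < v x" using v(2)[of x] by simp
    have "(\<lambda>j. 1 / real (Suc j)) \<longlonglongrightarrow> 0" by (rule lim_1_over_n[THEN LIMSEQ_Suc])
    then have "(\<lambda>j. v x / (v x + 1 / real (Suc j))) \<longlonglongrightarrow> v x / (v x + 0)"
      using pos by (intro tendsto_intros) auto
    then have "(\<lambda>j. z j x) \<longlonglongrightarrow> h x powr p * (v x / (v x + 0)) powr (p - 1)"
      unfolding z_def using pos by (intro tendsto_mult tendsto_const tendsto_powr) auto
    then show ?thesis using pos by (simp add: Z_def)
  qed
  have L1: "(\<lambda>j. \<integral>x. z j x \<partial>lebesgue) \<longlonglongrightarrow> (\<integral>x. Z x \<partial>lebesgue)"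
  proof (rule integral_dominated_convergence[OF _ _ ui])
    show "AE x in lebesgue. norm (z j x) \<le> \<bar>u x\<bar> powr p" for j
      using zh(1) order_trans[OF zh(2) hu(1)] u(2) by (intro AE_I2) simp
  qed (use lim in auto)
  have L2: "(\<lambda>j. \<integral>x. V x * z j x \<partial>lebesgue_on \<Omega>) \<longlonglongrightarrow> (\<integral>x. V x * Z x \<partial>lebesgue_on \<Omega>)"
  proof (rule integral_dominated_convergence)
    show "integrable (lebesgue_on \<Omega>) (\<lambda>x. \<bar>V x\<bar> * M powr p)" using V by auto
    show "AE x in lebesgue_on \<Omega>. norm (V x * z j x) \<le> \<bar>V x\<bar> * M powr p" for j
      using zh(1) order_trans[OF zh(2) hu(2)] by (intro AE_I2) (auto simp: abs_mult intro!: mult_left_mono)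
    show "AE x in lebesgue_on \<Omega>. (\<lambda>j. V x * z j x) \<longlonglongrightarrow> V x * Z x"
      using lim by (intro AE_I2 tendsto_mult tendsto_const)
  qed measurable
  note I = picone_identity[OF \<Omega> p M _ u v]
  have "(\<lambda>j. \<integral>w. K j w \<partial>lebesgue) \<longlonglongrightarrow> c"
  proof -
    have "(\<integral>w. K j w \<partial>lebesgue) = (\<integral>w. gagliardo_kernel s p h w \<partial>lebesgue)
      - 2 * (l * (\<integral>x. z j x \<partial>lebesgue) - (\<integral>x. V x * z j x \<partial>lebesgue_on \<Omega>))" for j
      unfolding K_def z_def h_def by (rule I(3)) simp
    then show ?thesis unfolding c_def using L1 L2 by (auto intro!: tendsto_intros)
  qed
  moreover have "integrable lebesgue (K j)" "AE w in lebesgue. 0 \<le> K j w" for j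
    unfolding K_def h_def by (auto intro!: AE_I2 I)
  ultimately show "0 \<le> c" "(\<integral>\<^sup>+ w. liminf (\<lambda>j. ennreal (picone_kernel s p h (\<lambda>x. v x + 1 / real (Suc j)) w))
    \<partial>lebesgue) \<le> ennreal c"
    using fatou_integral_limit[of lebesgue K c] unfolding K_def by auto
qed

section \<open>Positivity of nonnegative eigenfunctions\<close>

text \<open>
  The increment from a zero of the denominator to a point where it is positive contributes
  \<open>d^(p-1) a^p / e^(p-1)\<close> with a favourable sign, and this is unbounded as \<open>e\<close> tends to 0.
\<close>

lemma picone_defect_at_top:
  fixes a b d p :: real
  assumes p: "1 < p" and a: "0 < a" and d: "0 < d"
  shows "filterlim (\<lambda>j. picone_defect p a b (1 / real (Suc j)) (d + 1 / real (Suc j))) at_top sequentially"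
proof (rule filterlim_at_top_mono)
  show "filterlim (\<lambda>j. - (b powr p) + d powr (p - 1) * a powr p * real (Suc j) powr (p - 1)) at_top sequentially"
  proof (intro filterlim_tendsto_add_at_top[OF tendsto_const]
      filterlim_tendsto_pos_mult_at_top[OF tendsto_const])
    show "filterlim (\<lambda>j. real (Suc j) powr (p - 1)) at_top sequentially"
    proof -
      have "filterlim (\<lambda>x::real. exp ((p - 1) * ln x)) at_top at_top"
        using p by (intro filterlim_compose[OF exp_at_top]
            filterlim_tendsto_pos_mult_at_top[OF tendsto_const] ln_at_top) auto
      moreover have "filterlim (\<lambda>j. real (Suc j)) at_top sequentially"
        by (intro filterlim_compose[OF filterlim_real_sequentially filterlim_Suc])
      ultimately have "filterlim (\<lambda>j. exp ((p - 1) * ln (real (Suc j)))) at_top sequentially"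
        by (rule filterlim_compose)
      then show ?thesis by (simp add: powr_def)
    qed
  qed (use a d in auto)
  have "- (b powr p) + d powr (p - 1) * a powr p * real (Suc j) powr (p - 1)
      \<le> picone_defect p a b (1 / real (Suc j)) (d + 1 / real (Suc j))" for j
  proof -
    define e where "e = 1 / real (Suc j)"
    have e: "0 < e" by (simp add: e_def)
    have "d powr (p - 1) * (b powr p / (d + e) powr (p - 1)) = b powr p * (d / (d + e)) powr (p - 1)"
      using d e by (simp add: powr_divide)
    also have "\<dots> \<le> b powr p"
    proof -
      have "(d / (d + e)) powr (p - 1) \<le> 1 powr (p - 1)" using d e p by (intro powr_mono2) auto
      then show ?thesis by (intro mult_left_le) auto
    qed
    finally have 1: "d powr (p - 1) * (b powr p / (d + e) powr (p - 1)) \<le> b powr p" .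
    have 2: "a powr p / e powr (p - 1) = a powr p * real (Suc j) powr (p - 1)"
      by (simp add: e_def powr_divide)
    have "\<bar>e - (d + e)\<bar> powr (p - 2) * (e - (d + e)) = - (d powr (p - 1))"
      using abs_powr_mult_self[of "- d" p] d by simp
    then have "picone_defect p a b e (d + e) = \<bar>a - b\<bar> powr p + d powr (p - 1) * (a powr p / e powr (p - 1))
        - d powr (p - 1) * (b powr p / (d + e) powr (p - 1))"
      by (simp add: picone_defect_def algebra_simps)
    then show ?thesis
      using 1 powr_ge_zero[of "\<bar>a - b\<bar>" p] unfolding 2 e_def[symmetric] mult.assoc by linarith
  qed
  then show "\<forall>\<^sub>F j in sequentially. - (b powr p) + d powr (p - 1) * a powr p * real (Suc j) powr (p - 1)
      \<le> picone_defect p a b (1 / real (Suc j)) (d + 1 / real (Suc j))" by simp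
qed

text \<open>
  The strong minimum principle, relative to a function \<open>u\<close> of the space that is already known to be positive; \<open>u\<close>
  itself need not be an eigenfunction.
\<close>

lemma nonneg_eigenfunction_pos:
  fixes \<Omega> :: "'a::euclidean_space set" and u v :: "'a \<Rightarrow> real"
  assumes \<Omega>: "open \<Omega>" and p: "1 < p" and V: "integrable (lebesgue_on \<Omega>) V"
    and u: "u \<in> frac_sobolev0 s p \<Omega>" "\<And>x. 0 \<le> u x" "AE x in lebesgue. x \<in> \<Omega> \<longrightarrow> 0 < u x"
    and v: "eigenfunction s p \<Omega> V l v" "\<And>x. 0 \<le> v x"
  shows "AE x in lebesgue. x \<in> \<Omega> \<longrightarrow> 0 < v x"
proof -
  define h where "h = (\<lambda>x. min (u x) 1)"
  define K where "K = (\<lambda>j. picone_kernel s p h (\<lambda>x. v x + 1 / real (Suc j)))"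
  have v0: "v \<in> frac_sobolev0 s p \<Omega>" using v by (simp add: eigenfunction_def)
  have [measurable]: "u \<in> borel_measurable lebesgue" "v \<in> borel_measurable lebesgue"
    using u(1) v0 by (auto simp: frac_sobolev0_iff[OF \<Omega>] frac_sobolev_UNIV_iff)
  have [measurable]: "K j \<in> borel_measurable lebesgue" for j
    unfolding K_def h_def by (intro picone_kernel_measurable) measurable
  have "(\<integral>\<^sup>+ w. liminf (\<lambda>j. ennreal (K j w)) \<partial>lebesgue) \<noteq> \<infinity>"
    using picone_fatou(2)[OF \<Omega> p zero_less_one V u(1,2) v] unfolding K_def h_def
    by (auto simp: top_unique)
  then have "AE w in lebesgue. liminf (\<lambda>j. ennreal (K j w)) \<noteq> \<infinity>"
    by (rule nn_integral_PInf_AE[rotated]) measurable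
  then have "AE w in lebesgue. \<not> (0 < u (fst w) \<and> v (fst w) = 0 \<and> 0 < v (snd w))"
  proof (rule AE_mp, intro AE_I2 impI notI)
    fix w assume fin: "liminf (\<lambda>j. ennreal (K j w)) \<noteq> \<infinity>"
      and w: "0 < u (fst w) \<and> v (fst w) = 0 \<and> 0 < v (snd w)"
    obtain x y where xy: "w = (x, y)" by (cases w)
    define N where "N = norm (x - y) powr (real DIM('a) + s * p)"
    have "0 < N" using w by (auto simp: N_def xy)
    have "filterlim (\<lambda>j. inverse N * picone_defect p (h x) (h y) (1 / real (Suc j)) (v y + 1 / real (Suc j)))
        at_top sequentially"
      using w \<open>0 < N\<close> by (intro filterlim_tendsto_pos_mult_at_top[OF tendsto_const] picone_defect_at_top p)
        (auto simp: xy h_def)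
    then have "filterlim (\<lambda>j. K j w) at_top sequentially"
      using w by (simp add: K_def picone_kernel_def xy N_def divide_inverse mult.commute)
    then have "(\<lambda>j. ennreal (K j w)) \<longlonglongrightarrow> \<infinity>"
      by (simp add: ennreal_tendsto_top_eq_at_top)
    then show False using fin lim_imp_Liminf[of sequentially] by auto
  qed
  from AE_lebesgue_prodD[OF this]
  have "AE x in lebesgue. AE y in lebesgue. \<not> (0 < u x \<and> v x = 0 \<and> 0 < v y)" by simp
  then have "AE x in lebesgue. \<not> (0 < u x \<and> v x = 0)"
  proof (rule AE_mp, intro AE_I2 impI notI)
    fix x assume "AE y in lebesgue. \<not> (0 < u x \<and> v x = 0 \<and> 0 < v y)" "0 < u x \<and> v x = 0"
    then have "AE y in lebesgue. v y = 0"
      using v(2) by (auto simp: less_le)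
    then show False using v(1) by (simp add: eigenfunction_def)
  qed
  with u(3) show ?thesis by eventually_elim (use v(2) in \<open>auto simp: less_le\<close>)
qed

section \<open>Comparison of eigenvalues\<close>

text \<open>
  The numerator \<open>u\<close> is truncated at \<open>M = j + 1\<close>. Both \<open>[h]^p\<close> and the form of \<open>u\<close> against
  \<open>h^p / u^(p-1)\<close> (up to the factor 2) converge to \<open>[u]^p\<close>, so that only the eigenvalue terms remain in the limit.
\<close>

lemma eigenvalue_comparison:
  fixes \<Omega> :: "'a::euclidean_space set" and u v :: "'a \<Rightarrow> real"
  assumes \<Omega>: "open \<Omega>" and p: "1 < p" and V: "integrable (lebesgue_on \<Omega>) V"
    and u: "eigenfunction s p \<Omega> V k u" "\<And>x. 0 \<le> u x"
    and v: "eigenfunction s p \<Omega> V l v" "\<And>x. 0 \<le> v x" "AE x in lebesgue. x \<in> \<Omega> \<longrightarrow> 0 < v x"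
  shows "l \<le> k"
    and "(\<integral>\<^sup>+ w. ennreal (picone_kernel s p u v w) \<partial>lebesgue)
      \<le> ennreal (2 * (k - l) * (\<integral>x. u x powr p \<partial>lebesgue))"
proof -
  define h where "h = (\<lambda>j x. min (u x) (real (Suc j)))"
  define g where "g = (\<lambda>j x. power_tail p (real (Suc j)) (u x))"
  define F where "F = (\<lambda>j (x, y). \<bar>u x - u y\<bar> powr (p - 2) * (u x - u y) * (g j x - g j y) /
       norm (x - y) powr (real DIM('a) + s * p))"
  define G where "G = gagliardo_kernel s p u"
  define c where "c = (\<lambda>j. (\<integral>w. gagliardo_kernel s p (h j) w \<partial>lebesgue)
      - (\<integral>w. F j w \<partial>lebesgue) + 2 * (k - l) * (\<integral>x. h j x powr p \<partial>lebesgue))"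
  have u0: "u \<in> frac_sobolev0 s p \<Omega>" using u by (simp add: eigenfunction_def)
  have v0: "v \<in> frac_sobolev0 s p \<Omega>" using v by (simp add: eigenfunction_def)
  have us: "u \<in> frac_sobolev s p UNIV" using u0 by (simp add: frac_sobolev0_iff[OF \<Omega>])
  have um[measurable]: "u \<in> borel_measurable lebesgue" and vm[measurable]: "v \<in> borel_measurable lebesgue"
    and ui: "integrable lebesgue (\<lambda>x. u x powr p)" and Gi: "integrable lebesgue G"
    using us v0 u(2) by (auto simp: frac_sobolev0_iff[OF \<Omega>] frac_sobolev_UNIV_iff G_def)
  have hm[measurable]: "h j \<in> borel_measurable lebesgue" for j unfolding h_def by measurable
  have gm[measurable]: "g j \<in> borel_measurable lebesgue" for j unfolding g_def power_tail_def by measurable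
  have g0: "g j \<in> frac_sobolev0 s p \<Omega>" for j
    unfolding g_def by (rule power_tail_test_function[OF \<Omega> p _ u0]) simp
  have vanish: "u x = 0" if "x \<notin> \<Omega>" for x using u0 that by (simp add: frac_sobolev0_iff[OF \<Omega>])
  have evh: "\<forall>\<^sub>F j in sequentially. h j x = u x" for x
    using eventually_ge_at_top[of "nat \<lceil>u x\<rceil>"] by eventually_elim (auto simp: h_def)
  have evg: "\<forall>\<^sub>F j in sequentially. g j x = u x" for x
    using eventually_ge_at_top[of "nat \<lceil>u x\<rceil>"] by eventually_elim (auto simp: g_def power_tail_def)
  have fatou: "0 \<le> c j \<and> (\<integral>\<^sup>+ w. ennreal (picone_kernel s p (h j) v w) \<partial>lebesgue) \<le> ennreal (c j)" for j
  proof -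
    define Z where "Z = (\<lambda>x. if v x = 0 then 0 else h j x powr p)"
    have Zm[measurable]: "Z \<in> borel_measurable lebesgue" unfolding Z_def by measurable
    have Zae: "AE x in lebesgue. Z x = h j x powr p"
      using v(3) by eventually_elim (use vanish in \<open>auto simp: Z_def h_def\<close>)
    have [measurable]: "V \<in> borel_measurable (lebesgue_on \<Omega>)" using V by auto
    have [measurable]: "Z \<in> borel_measurable (lebesgue_on \<Omega>)" "h j \<in> borel_measurable (lebesgue_on \<Omega>)"
      by (intro measurable_restrict_space1 Zm hm)+
    have Zae': "AE x in lebesgue_on \<Omega>. Z x = h j x powr p"
      using Zae \<Omega> by (simp add: AE_restrict_space_iff) (auto elim: eventually_mono)
    have IZ: "(\<integral>x. Z x \<partial>lebesgue) = (\<integral>x. h j x powr p \<partial>lebesgue)"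
      using Zae by (intro integral_cong_AE) auto
    have IVZ: "(\<integral>x. V x * Z x \<partial>lebesgue_on \<Omega>) = (\<integral>x. V x * h j x powr p \<partial>lebesgue_on \<Omega>)"
      using Zae' by (intro integral_cong_AE) auto
    have hp: "u x powr (p - 1) * g j x = h j x powr p" for x
      unfolding g_def h_def using p u(2) by (intro powr_mult_power_tail) auto
    \<comment> \<open>The equation of \<open>u\<close> replaces the potential term, which is common to both equations.\<close>
    have "(\<integral>w. F j w \<partial>lebesgue) = 2 * frac_form s p u (g j)" by (simp add: frac_form_def F_def)
    also have "\<dots> = 2 * (k * (\<integral>x. h j x powr p \<partial>lebesgue) - (\<integral>x. V x * h j x powr p \<partial>lebesgue_on \<Omega>))"
      using eigenfunction_eqD[OF u g0] by (simp add: hp)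
    finally have cj: "c j = (\<integral>w. gagliardo_kernel s p (h j) w \<partial>lebesgue)
      - 2 * (l * (\<integral>x. Z x \<partial>lebesgue) - (\<integral>x. V x * Z x \<partial>lebesgue_on \<Omega>))"
      unfolding c_def IZ IVZ by (simp add: algebra_simps)
    have A: "0 \<le> c j"
      unfolding cj Z_def h_def by (rule picone_fatou(1)[OF \<Omega> p _ V u0 u(2) v(1,2)]) simp
    have B: "(\<integral>\<^sup>+ w. liminf (\<lambda>i. ennreal (picone_kernel s p (h j) (\<lambda>x. v x + 1 / real (Suc i)) w))
      \<partial>lebesgue) \<le> ennreal (c j)"
      unfolding cj Z_def h_def by (rule picone_fatou(2)[OF \<Omega> p _ V u0 u(2) v(1,2)]) simp
    have "AE w in lebesgue. liminf (\<lambda>i. ennreal (picone_kernel s p (h j) (\<lambda>x. v x + 1 / real (Suc i)) w))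
        = ennreal (picone_kernel s p (h j) v w)"
      using AE_lebesgue_prodI[OF v(3)]
    proof eventually_elim
      case (elim w)
      have ok: "0 < v x \<or> h j x = 0" if "x \<in> \<Omega> \<longrightarrow> 0 < v x" for x
        using that vanish[of x] by (auto simp: h_def)
      have "(\<lambda>i. picone_kernel s p (h j) (\<lambda>x. v x + 1 / real (Suc i)) w) \<longlonglongrightarrow> picone_kernel s p (h j) v w"
        unfolding picone_kernel_def split_beta divide_inverse[of _ "_ powr _"] using elim ok v(2)
        by (intro tendsto_mult tendsto_const picone_defect_tendsto lim_1_over_n[THEN LIMSEQ_Suc]) auto
      then show ?case by (intro lim_imp_Liminf tendsto_ennrealI) auto
    qed
    from nn_integral_cong_AE[OF this] A B show ?thesis by simp
  qed
  \<comment> \<open>All three limits are dominated, and at each point the integrands are eventually constant in \<open>j\<close>.\<close>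
  have lim1: "(\<lambda>j. \<integral>w. gagliardo_kernel s p (h j) w \<partial>lebesgue) \<longlonglongrightarrow> (\<integral>w. G w \<partial>lebesgue)"
  proof (rule integral_dominated_convergence[OF _ _ Gi])
    show "gagliardo_kernel s p (h j) \<in> borel_measurable lebesgue" for j
      by (rule gagliardo_kernel_measurable) measurable
    show "AE w in lebesgue. (\<lambda>j. gagliardo_kernel s p (h j) w) \<longlonglongrightarrow> G w"
    proof (intro AE_I2 tendsto_eventually)
      show "\<forall>\<^sub>F j in sequentially. gagliardo_kernel s p (h j) w = G w" for w
        using evh[of "fst w"] evh[of "snd w"]
        by eventually_elim (simp add: gagliardo_kernel_def G_def split_beta)
    qed
    show "AE w in lebesgue. norm (gagliardo_kernel s p (h j) w) \<le> G w" for j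
      using p by (intro AE_I2) (auto simp: gagliardo_kernel_def G_def h_def intro!: divide_right_mono powr_mono2)
  qed (use Gi in auto)
  have lim2: "(\<lambda>j. \<integral>w. F j w \<partial>lebesgue) \<longlonglongrightarrow> (\<integral>w. G w \<partial>lebesgue)"
  proof (rule integral_dominated_convergence)
    show "integrable lebesgue (\<lambda>w. p * G w)" using Gi by simp
    show "F j \<in> borel_measurable lebesgue" for j
      unfolding F_def by (rule frac_form_integrand_measurable) measurable
    have self: "\<bar>a\<bar> powr (p - 2) * a * a = \<bar>a\<bar> powr p" for a :: real
      using powr_add[of "\<bar>a\<bar>" "p - 1" 1] by (cases "a = 0") (auto simp: abs_powr_mult_self sgn_if)
    show "AE w in lebesgue. (\<lambda>j. F j w) \<longlonglongrightarrow> G w"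
    proof (intro AE_I2 tendsto_eventually)
      show "\<forall>\<^sub>F j in sequentially. F j w = G w" for w
        using evg[of "fst w"] evg[of "snd w"]
        by eventually_elim (simp add: gagliardo_kernel_def G_def F_def split_beta self)
    qed
    have "\<bar>\<bar>u x - u y\<bar> powr (p - 2) * (u x - u y) * (g j x - g j y)\<bar> \<le> p * \<bar>u x - u y\<bar> powr p" for j x y
    proof -
      have "\<bar>\<bar>u x - u y\<bar> powr (p - 2) * (u x - u y) * (g j x - g j y)\<bar>
          \<le> \<bar>u x - u y\<bar> powr (p - 2) * \<bar>u x - u y\<bar> * (p * \<bar>u x - u y\<bar>)"
        unfolding abs_mult g_def using p by (intro mult_mono power_tail_lipschitz) auto
      also have "\<dots> = p * \<bar>u x - u y\<bar> powr p" using self[of "\<bar>u x - u y\<bar>"] by (simp add: mult_ac)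
      finally show ?thesis .
    qed
    then show "AE w in lebesgue. norm (F j w) \<le> p * G w" for j
      by (intro AE_I2) (auto simp: F_def G_def gagliardo_kernel_def abs_mult intro!: divide_right_mono)
  qed (use Gi in auto)
  have lim3: "(\<lambda>j. \<integral>x. h j x powr p \<partial>lebesgue) \<longlonglongrightarrow> (\<integral>x. u x powr p \<partial>lebesgue)"
  proof (rule integral_dominated_convergence[OF _ _ ui])
    show "AE x in lebesgue. (\<lambda>j. h j x powr p) \<longlonglongrightarrow> u x powr p"
    proof (intro AE_I2 tendsto_eventually)
      show "\<forall>\<^sub>F j in sequentially. h j x powr p = u x powr p" for x
        using evh[of x] by eventually_elim simp
    qed
    show "AE x in lebesgue. norm (h j x powr p) \<le> u x powr p" for j
      using p u(2) by (intro AE_I2) (auto simp: h_def intro!: powr_mono2)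
  qed measurable
  define C where "C = 2 * (k - l) * (\<integral>x. u x powr p \<partial>lebesgue)"
  have limc: "c \<longlonglongrightarrow> C"
    using tendsto_add[OF tendsto_diff[OF lim1 lim2] tendsto_mult[OF tendsto_const[of "2 * (k - l)"] lim3]]
    by (simp add: c_def C_def)
  then have "0 \<le> C" by (rule LIMSEQ_le_const) (use fatou in auto)
  have "0 < (\<integral>x. u x powr p \<partial>lebesgue)"
  proof (rule ccontr)
    assume "\<not> 0 < (\<integral>x. u x powr p \<partial>lebesgue)"
    moreover have "0 \<le> (\<integral>x. u x powr p \<partial>lebesgue)" by (intro integral_nonneg_AE) auto
    ultimately have "(\<integral>x. u x powr p \<partial>lebesgue) = 0" by simp
    then have "AE x in lebesgue. u x powr p = 0"
      using ui by (subst (asm) integral_nonneg_eq_0_iff_AE) auto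
    then show False using u(1) by (simp add: eigenfunction_def)
  qed
  then show "l \<le> k" using \<open>0 \<le> C\<close> by (simp add: C_def zero_le_mult_iff)
  have "(\<integral>\<^sup>+ w. ennreal (picone_kernel s p u v w) \<partial>lebesgue)
      = (\<integral>\<^sup>+ w. liminf (\<lambda>j. ennreal (picone_kernel s p (h j) v w)) \<partial>lebesgue)"
  proof (intro nn_integral_cong lim_imp_Liminf[symmetric] tendsto_eventually)
    show "\<forall>\<^sub>F j in sequentially. ennreal (picone_kernel s p (h j) v w) = ennreal (picone_kernel s p u v w)" for w
      using evh[of "fst w"] evh[of "snd w"] by eventually_elim (simp add: picone_kernel_def split_beta)
  qed auto
  also have "\<dots> \<le> liminf (\<lambda>j. \<integral>\<^sup>+ w. ennreal (picone_kernel s p (h j) v w) \<partial>lebesgue)"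
    by (intro nn_integral_liminf measurable_compose[OF picone_kernel_measurable[OF hm vm]]) auto
  also have "\<dots> \<le> liminf (\<lambda>j. ennreal (c j))" using fatou by (intro Liminf_mono) auto
  also have "\<dots> = ennreal C" using limc by (intro lim_imp_Liminf tendsto_ennrealI) auto
  finally show "(\<integral>\<^sup>+ w. ennreal (picone_kernel s p u v w) \<partial>lebesgue)
      \<le> ennreal (2 * (k - l) * (\<integral>x. u x powr p \<partial>lebesgue))" by (simp add: C_def)
qed

section \<open>Simplicity among nonnegative eigenfunctions\<close>

lemma Lp_space_imp_integrable:
  fixes \<Omega> :: "'a::euclidean_space set"
  assumes q: "1 \<le> q" and \<Omega>: "\<Omega> \<in> lmeasurable" and V: "V \<in> Lp_space q \<Omega>"
  shows "integrable (lebesgue_on \<Omega>) V"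
proof (rule Bochner_Integration.integrable_bound)
  have "finite_measure (lebesgue_on \<Omega>)"
    using \<Omega> by (intro finite_measureI) (auto simp: emeasure_restrict_space fmeasurable_def)
  then have "integrable (lebesgue_on \<Omega>) (\<lambda>x. 1 :: real)"
    by (simp add: finite_measure.integrable_const)
  then show "integrable (lebesgue_on \<Omega>) (\<lambda>x. 1 + \<bar>V x\<bar> powr q)"
    using V by (simp add: Lp_space_def)
  have "\<bar>V x\<bar> \<le> 1 + \<bar>V x\<bar> powr q" for x
  proof (cases "\<bar>V x\<bar> \<le> 1")
    case True
    then show ?thesis using powr_ge_zero[of "\<bar>V x\<bar>" q] by linarith
  next
    case False
    then show ?thesis using powr_mono[OF q, of "\<bar>V x\<bar>"] by simp
  qed
  then show "AE x in lebesgue_on \<Omega>. norm (V x) \<le> norm (1 + \<bar>V x\<bar> powr q)"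
    by (intro AE_I2) simp
qed (use V in \<open>simp add: Lp_space_def\<close>)

text \<open>
  An eigenfunction that is nonnegative almost everywhere may be replaced by its absolute value,
  which is nonnegative everywhere.
\<close>

lemma eigenfunction_abs:
  fixes \<Omega> :: "'a::euclidean_space set" and u :: "'a \<Rightarrow> real"
  assumes \<Omega>: "open \<Omega>" and p: "1 < p" and u: "eigenfunction s p \<Omega> V l u"
    and V: "V \<in> borel_measurable (lebesgue_on \<Omega>)"
    and nonneg: "AE x in lebesgue_on \<Omega>. 0 \<le> u x"
  shows "eigenfunction s p \<Omega> V l (\<lambda>x. \<bar>u x\<bar>)" and "AE x in lebesgue. \<bar>u x\<bar> = u x"
proof -
  have \<Omega>l: "\<Omega> \<in> sets lebesgue" using \<Omega> by auto
  have u0: "u \<in> frac_sobolev0 s p \<Omega>" using u by (simp add: eigenfunction_def)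
  then have us: "u \<in> frac_sobolev s p UNIV" and vanish: "\<And>x. x \<notin> \<Omega> \<Longrightarrow> u x = 0"
    by (auto simp: frac_sobolev0_iff[OF \<Omega>])
  have um[measurable]: "u \<in> borel_measurable lebesgue" using us by (simp add: frac_sobolev_UNIV_iff)
  have [measurable]: "u \<in> borel_measurable (lebesgue_on \<Omega>)" by (intro measurable_restrict_space1 um)
  have abs_on: "AE x in lebesgue_on \<Omega>. \<bar>u x\<bar> = u x" using nonneg by eventually_elim simp
  have "AE x in lebesgue. x \<in> \<Omega> \<longrightarrow> 0 \<le> u x" using nonneg \<Omega>l by (simp add: AE_restrict_space_iff)
  then show ae: "AE x in lebesgue. \<bar>u x\<bar> = u x" by eventually_elim (use vanish in auto)
  have ae2: "AE z in lebesgue. \<bar>u (fst z)\<bar> = u (fst z) \<and> \<bar>u (snd z)\<bar> = u (snd z)"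
    using AE_lebesgue_prodI[OF ae] .
  have abs_s: "(\<lambda>x. \<bar>u x\<bar>) \<in> frac_sobolev s p UNIV"
    using p by (intro frac_sobolev_dominated[OF _ zero_le_one order_refl us us]) auto
  then have abs0: "(\<lambda>x. \<bar>u x\<bar>) \<in> frac_sobolev0 s p \<Omega>" using vanish by (simp add: frac_sobolev0_iff[OF \<Omega>])
  have "frac_form s p (\<lambda>x. \<bar>u x\<bar>) w + (\<integral>x. V x * \<bar>\<bar>u x\<bar>\<bar> powr (p - 2) * \<bar>u x\<bar> * w x \<partial>lebesgue_on \<Omega>)
          = l * (\<integral>x. \<bar>\<bar>u x\<bar>\<bar> powr (p - 2) * \<bar>u x\<bar> * w x \<partial>lebesgue)"
    if w: "w \<in> frac_sobolev0 s p \<Omega>" for w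
  proof -
    have wm[measurable]: "w \<in> borel_measurable lebesgue"
      using w by (auto simp: frac_sobolev0_iff[OF \<Omega>] frac_sobolev_UNIV_iff)
    have [measurable]: "w \<in> borel_measurable (lebesgue_on \<Omega>)" by (intro measurable_restrict_space1 wm)
    note [measurable] = V
    have "frac_form s p (\<lambda>x. \<bar>u x\<bar>) w = frac_form s p u w"
      unfolding frac_form_def
    proof (intro arg_cong[where f = "\<lambda>t. 1 / 2 * t"] integral_cong_AE frac_form_integrand_measurable)
      show "AE z in lebesgue.
        (case z of (x, y) \<Rightarrow> \<bar>\<bar>u x\<bar> - \<bar>u y\<bar>\<bar> powr (p - 2) * (\<bar>u x\<bar> - \<bar>u y\<bar>) * (w x - w y) /
          norm (x - y) powr (real DIM('a) + s * p)) =
        (case z of (x, y) \<Rightarrow> \<bar>u x - u y\<bar> powr (p - 2) * (u x - u y) * (w x - w y) /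
          norm (x - y) powr (real DIM('a) + s * p))"
        using ae2 by eventually_elim (simp add: split_beta)
    qed measurable
    moreover have "(\<integral>x. V x * \<bar>\<bar>u x\<bar>\<bar> powr (p - 2) * \<bar>u x\<bar> * w x \<partial>lebesgue_on \<Omega>)
        = (\<integral>x. V x * \<bar>u x\<bar> powr (p - 2) * u x * w x \<partial>lebesgue_on \<Omega>)"
      using abs_on by (intro integral_cong_AE) auto
    moreover have "(\<integral>x. \<bar>\<bar>u x\<bar>\<bar> powr (p - 2) * \<bar>u x\<bar> * w x \<partial>lebesgue)
        = (\<integral>x. \<bar>u x\<bar> powr (p - 2) * u x * w x \<partial>lebesgue)"
      using ae by (intro integral_cong_AE) auto
    ultimately show ?thesis using u w by (simp add: eigenfunction_def)
  qed
  then show "eigenfunction s p \<Omega> V l (\<lambda>x. \<bar>u x\<bar>)"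
    using abs0 u by (simp add: eigenfunction_def)
qed

lemma AE_proportional:
  fixes u v :: "'a::euclidean_space \<Rightarrow> real"
  assumes u: "AE x in lebesgue. x \<in> \<Omega> \<longrightarrow> 0 < u x"
    and cross: "AE z in lebesgue. fst z \<in> \<Omega> \<and> snd z \<in> \<Omega> \<longrightarrow> u (fst z) * v (snd z) = u (snd z) * v (fst z)"
  shows "\<exists>k. AE x in lebesgue. x \<in> \<Omega> \<longrightarrow> v x = k * u x"
proof (cases "AE x in lebesgue. x \<notin> \<Omega>")
  case True
  then have "AE x in lebesgue. x \<in> \<Omega> \<longrightarrow> v x = 0 * u x" by eventually_elim simp
  then show ?thesis by blast
next
  case False
  have "AE x in lebesgue. AE y in lebesgue. x \<in> \<Omega> \<and> y \<in> \<Omega> \<longrightarrow> u x * v y = u y * v x"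
    using AE_lebesgue_prodD[OF cross] by simp
  with u have "AE x in lebesgue. (x \<in> \<Omega> \<longrightarrow> 0 < u x) \<and>
      (AE y in lebesgue. x \<in> \<Omega> \<and> y \<in> \<Omega> \<longrightarrow> u x * v y = u y * v x)"
    by eventually_elim simp
  then obtain x where x: "x \<in> \<Omega>" "0 < u x"
      "AE y in lebesgue. x \<in> \<Omega> \<and> y \<in> \<Omega> \<longrightarrow> u x * v y = u y * v x"
    using False by (metis (mono_tags, lifting) eventually_mono)
  from x(3) have "AE y in lebesgue. y \<in> \<Omega> \<longrightarrow> v y = (v x / u x) * u y"
    by eventually_elim (use x(1,2) in \<open>auto simp: field_simps\<close>)
  then show ?thesis by blast
qed

theorem theorem3p6:
  fixes \<Omega> :: "'a::euclidean_space set" and V u v :: "'a \<Rightarrow> real" and s p q l :: real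
  assumes "0 < s" and "s < 1" and "1 < p"
    and "bounded \<Omega>" and "extension_domain s p \<Omega>"
    and "1 < q" and "real DIM('a) / (s * p) < q"
    and "V \<in> Lp_space q \<Omega>"
    and "eigenfunction s p \<Omega> V (first_eigenvalue s p \<Omega> V) u"
    and "AE x in lebesgue_on \<Omega>. 0 < u x"
    and "0 < l"
    and "eigenfunction s p \<Omega> V l v"
    and "AE x in lebesgue_on \<Omega>. 0 \<le> v x"
  shows "l = first_eigenvalue s p \<Omega> V \<and> (\<exists>k::real. AE x in lebesgue_on \<Omega>. v x = k * u x)"
proof -
  define l1 where "l1 = first_eigenvalue s p \<Omega> V"
  define u' where "u' = (\<lambda>x. \<bar>u x\<bar>)"
  define v' where "v' = (\<lambda>x. \<bar>v x\<bar>)"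
  note p = \<open>1 < p\<close>
  have \<Omega>: "open \<Omega>" using \<open>extension_domain s p \<Omega>\<close> by (simp add: extension_domain_def)
  then have \<Omega>l: "\<Omega> \<in> sets lebesgue" and "\<Omega> \<in> lmeasurable"
    using \<open>bounded \<Omega>\<close> by (auto intro: lmeasurable_open)
  then have V: "integrable (lebesgue_on \<Omega>) V"
    using Lp_space_imp_integrable[of q \<Omega> V] assms by simp
  have u_nonneg: "AE x in lebesgue_on \<Omega>. 0 \<le> u x" using assms(10) by eventually_elim simp
  note eu = eigenfunction_abs[OF \<Omega> p assms(9) borel_measurable_integrable[OF V] u_nonneg,
      folded l1_def u'_def]
  note ev = eigenfunction_abs[OF \<Omega> p assms(12) borel_measurable_integrable[OF V] assms(13),
      folded v'_def]
  have nonneg: "0 \<le> u' x" "0 \<le> v' x" for x by (auto simp: u'_def v'_def)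
  have upos: "AE x in lebesgue. x \<in> \<Omega> \<longrightarrow> 0 < u' x"
    using assms(10) \<Omega>l by (auto simp: AE_restrict_space_iff u'_def elim: eventually_mono)
  have u0: "u' \<in> frac_sobolev0 s p \<Omega>" using eu by (simp add: eigenfunction_def)
  have vpos: "AE x in lebesgue. x \<in> \<Omega> \<longrightarrow> 0 < v' x"
    by (rule nonneg_eigenfunction_pos[OF \<Omega> p V u0 nonneg(1) upos ev(1) nonneg(2)])
  \<comment> \<open>With both functions positive, the comparison can be used in both directions.\<close>
  have eq: "l = l1"
    using eigenvalue_comparison(1)[OF \<Omega> p V eu(1) nonneg(1) ev(1) nonneg(2) vpos]
      eigenvalue_comparison(1)[OF \<Omega> p V ev(1) nonneg(2) eu(1) nonneg(1) upos] by simp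
  have [measurable]: "u' \<in> borel_measurable lebesgue" "v' \<in> borel_measurable lebesgue"
    using eu(1) ev(1) by (auto simp: eigenfunction_def frac_sobolev0_iff[OF \<Omega>] frac_sobolev_UNIV_iff)
  have "(\<integral>\<^sup>+ w. ennreal (picone_kernel s p u' v' w) \<partial>lebesgue) = 0"
    using eigenvalue_comparison(2)[OF \<Omega> p V eu(1) nonneg(1) ev(1) nonneg(2) vpos] by (simp add: eq)
  then have "AE w in lebesgue. ennreal (picone_kernel s p u' v' w) = 0"
    by (subst (asm) nn_integral_0_iff_AE)
      (auto intro: measurable_compose[OF picone_kernel_measurable])
  then have "AE z in lebesgue. fst z \<in> \<Omega> \<and> snd z \<in> \<Omega> \<longrightarrow> u' (fst z) * v' (snd z) = u' (snd z) * v' (fst z)"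
    using AE_lebesgue_prodI[OF vpos]
  proof eventually_elim
    case (elim z)
    obtain x y where z: "z = (x, y)" by (cases z)
    show ?case
    proof (cases "x = y")
      case False
      have "u' x * v' y = u' y * v' x" if xy: "x \<in> \<Omega>" "y \<in> \<Omega>"
      proof -
        have vxy: "0 < v' x" "0 < v' y" using elim xy by (auto simp: z)
        have "picone_defect p (u' x) (u' y) (v' x) (v' y) \<le> 0"
          using elim(1) False by (simp add: z picone_kernel_def ennreal_eq_0_iff divide_le_0_iff)
        then have "picone_defect p (u' x) (u' y) (v' x) (v' y) = 0"
          using picone_defect_nonneg[OF p nonneg(1) nonneg(1) vxy] by (simp add: antisym)
        then show ?thesis by (rule picone_defect_eq_0D[OF p nonneg(1) nonneg(1) vxy])
      qed
      then show ?thesis by (simp add: z)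
    qed (simp add: z)
  qed
  from AE_proportional[OF upos this] obtain k where "AE x in lebesgue. x \<in> \<Omega> \<longrightarrow> v' x = k * u' x" ..
  with eu(2) ev(2) have "AE x in lebesgue. x \<in> \<Omega> \<longrightarrow> v x = k * u x"
    by eventually_elim (simp add: u'_def v'_def)
  then have "AE x in lebesgue_on \<Omega>. v x = k * u x" using \<Omega>l by (simp add: AE_restrict_space_iff)
  then show ?thesis using eq by (auto simp: l1_def)
qed

end
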